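(* Let $m\ge 1$, let $X_1,X_2,\ldots$ be non-degenerate real-valued i.i.d. random variables with distribution $F$, and let $h:\mathbb{R}^m\to\mathbb{R}$ be a Borel-measurable kernel, symmetric in its arguments, with finite mean $\theta=\mathbb{E}\,h(X_1,\ldots,X_m)$. If $\mathbb{E}|h(X_1,\ldots,X_m)|^{5/3}<\infty$ and $\tilde h_1(X_1)\in DAN$, where $\tilde h_1(x)=\mathbb{E}\big(h(X_1,\ldots,X_m)-\theta\mid X_1=x\big)$, then, as $n\to\infty$, $$\left|\frac{n-1}{m^2\,\ell^2(n)}\sum_{i=1}^n(U^i_{n-1}-U_n)^2-\frac{1}{n\,\ell^2(n)}\sum_{i=1}^n\tilde h_1^2(X_i)\right|=o_P(1).$$
   Context: For $n\ge m$, $$U_n=\binom{n}{m}^{-1}\sum_{1\le i_1<\cdots<i_m\le n}h(X_{i_1},\ldots,X_{i_m}),$$ and for $i=1,\ldots,n$ the jackknifed version of $U_n$ (omitting $X_i$) is $$U^i_{n-1}=\binom{n-1}{m}^{-1}\sum_{\substack{1\le j_1<\cdots<j_m\le n\\ j_1,\ldots,j_m\ne i}}h(X_{j_1},\ldots,X_{j_m}).$$ Domain of attraction of the normal law: for i.i.d. random variables $Y,Y_1,Y_2,\ldots$ we write $Y\in DAN$ if there are constants $A_n$ and $B_n>0$ with $\big(\sum_{i=1}^nY_i-A_n\big)/B_n\to_d N(0,1)$ as $n\to\infty$. It is known that one can take $A_n=n\mathbb{E}(Y)$ and $B_n=n^{1/2}\ell_Y(n)$, where $\ell_Y$ is a slowly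 varying function at infinity determined by the law of $Y$ (with $\ell_Y(n)=\sqrt{Var(Y)}>0$ if $Var(Y)<\infty$, and $\ell_Y(n)\to\infty$ if $Var(Y)=\infty$). Here $\ell(\cdot)$ denotes this slowly varying function for $Y=\tilde h_1(X_1)$; since $\mathbb{E}\tilde h_1(X_1)=0$, this means $\sum_{i=1}^n\tilde h_1(X_i)/(n^{1/2}\ell(n))\to_d N(0,1)$. *)

theory Defs
  imports "HOL-Probability.Probability" "HOL-Combinatorics.Permutations"
begin

(* Indices start at 0 throughout: the sample of size n is x 0, ..., x (n - 1), and a point of
   R^m is an element of the extensional function space {..<m} \<rightarrow>\<^sub>E UNIV = space (Pi\<^sub>M {..<m} (\<lambda>_. borel)). *)

definition symmetric_kernel :: "nat \<Rightarrow> ((nat \<Rightarrow> real) \<Rightarrow> real) \<Rightarrow> bool" where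
  "symmetric_kernel m h \<longleftrightarrow>
     (\<forall>p. p permutes {..<m} \<longrightarrow>
       (\<forall>x \<in> {..<m} \<rightarrow>\<^sub>E UNIV. h (\<lambda>k\<in>{..<m}. x (p k)) = h x))"

definition increasing_tuples :: "nat \<Rightarrow> nat set \<Rightarrow> (nat \<Rightarrow> nat) set" where
  "increasing_tuples m A = {j \<in> {..<m} \<rightarrow>\<^sub>E A. strict_mono_on {..<m} j}"

definition U_stat :: "nat \<Rightarrow> ((nat \<Rightarrow> real) \<Rightarrow> real) \<Rightarrow> (nat \<Rightarrow> real) \<Rightarrow> nat \<Rightarrow> real" where
  "U_stat m h x n =
     inverse (real (n choose m)) *
     (\<Sum>j\<in>increasing_tuples m {..<n}. h (\<lambda>k\<in>{..<m}. x (j k)))"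

definition U_jack ::
  "nat \<Rightarrow> ((nat \<Rightarrow> real) \<Rightarrow> real) \<Rightarrow> (nat \<Rightarrow> real) \<Rightarrow> nat \<Rightarrow> nat \<Rightarrow> real" where
  "U_jack m h x n i =
     inverse (real ((n - 1) choose m)) *
     (\<Sum>j\<in>increasing_tuples m ({..<n} - {i}). h (\<lambda>k\<in>{..<m}. x (j k)))"

(* g is a version of the factorised conditional expectation y \<mapsto> E (Z | Y = y): a Borel function
   with g (Y) = E (Z | \<sigma>(Y)) almost surely. *)
definition cond_exp_given ::
  "'a measure \<Rightarrow> ('a \<Rightarrow> real) \<Rightarrow> ('a \<Rightarrow> real) \<Rightarrow> (real \<Rightarrow> real) \<Rightarrow> bool" where
  "cond_exp_given M Z Y g \<longleftrightarrow>
     g \<in> borel_measurable borel \<and>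
     (AE \<omega> in M. g (Y \<omega>) = real_cond_exp M (vimage_algebra (space M) Y borel) Z \<omega>)"

(* Meant for i.i.d. sequences Y; it then depends only on the common law. *)
definition DAN :: "'a measure \<Rightarrow> (nat \<Rightarrow> 'a \<Rightarrow> real) \<Rightarrow> bool" where
  "DAN M Y \<longleftrightarrow>
     (\<exists>A B :: nat \<Rightarrow> real. (\<forall>n. B n > 0) \<and>
        weak_conv_m (\<lambda>n. distr M borel (\<lambda>\<omega>. ((\<Sum>i<n. Y i \<omega>) - A n) / B n))
          std_normal_distribution)"

definition slowly_varying :: "(real \<Rightarrow> real) \<Rightarrow> bool" where
  "slowly_varying L \<longleftrightarrow>
     L \<in> borel_measurable borel \<and> (\<forall>\<^sub>F x in at_top. L x > 0) \<and>
     (\<forall>c>0. ((\<lambda>x. L (c * x) / L x) \<longlongrightarrow> 1) at_top)"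

(* L is an admissible slowly varying factor for the i.i.d. sequence Y: one may take A n = n E(Y)
   and B n = sqrt n * L n in DAN, with L n = sqrt (Var Y) if Var Y is finite and
   L n \<longlonglongrightarrow> \<infinity> otherwise. For Y in DAN this determines L n up to a factor tending to 1. *)
definition DAN_factor :: "'a measure \<Rightarrow> (nat \<Rightarrow> 'a \<Rightarrow> real) \<Rightarrow> (real \<Rightarrow> real) \<Rightarrow> bool" where
  "DAN_factor M Y L \<longleftrightarrow>
     slowly_varying L \<and>
     (let \<mu> = (\<integral>\<omega>. Y 0 \<omega> \<partial>M); V = (\<lambda>\<omega>. (Y 0 \<omega> - \<mu>)\<^sup>2) in
        (if integrable M V
         then \<forall>n\<ge>1. L (real n) = sqrt (\<integral>\<omega>. V \<omega> \<partial>M)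
         else filterlim (\<lambda>n. L (real n)) at_top sequentially) \<and>
        weak_conv_m
          (\<lambda>n. distr M borel (\<lambda>\<omega>. ((\<Sum>i<n. Y i \<omega>) - real n * \<mu>) / (sqrt (real n) * L (real n))))
          std_normal_distribution)"

definition oP_1 :: "'a measure \<Rightarrow> (nat \<Rightarrow> 'a \<Rightarrow> real) \<Rightarrow> bool" where
  "oP_1 M Z \<longleftrightarrow>
     (\<forall>\<epsilon>>0. (\<lambda>n. measure M {\<omega> \<in> space M. \<bar>Z n \<omega>\<bar> > \<epsilon>}) \<longlonglongrightarrow> 0)"

end

theory Submission
  imports Defs
begin

text \<open>Write \<open>q\<^sub>i\<close> for the average of \<open>h\<close> over the \<open>m\<close>-subsets of the sample that contain \<open>i\<close>. Then
  \<open>U\<^sub>n\<close> is the mean of the \<open>q\<^sub>i\<close> and \<open>U\<^sup>i\<^sub>n\<^sub>-\<^sub>1 - U\<^sub>n = m / (n - m) * (U\<^sub>n - q\<^sub>i)\<close>, so everything follows by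
  Cauchy--Schwarz from three facts about \<open>r\<^sub>i = q\<^sub>i - \<theta> - h\<^sub>1(X\<^sub>i)\<close> and \<open>h\<^sub>1\<close>:
  the sum of the \<open>r\<^sub>i\<^sup>2\<close> is \<open>o\<^sub>P(n)\<close>, the sum of the \<open>h\<^sub>1(X\<^sub>i)\<^sup>2\<close> is \<open>O\<^sub>P(n \<ell>\<^sup>2(n))\<close>, and the mean of
  the \<open>h\<^sub>1(X\<^sub>i)\<close> is \<open>o\<^sub>P(\<ell>(n))\<close>.

  For the first, truncate \<open>h\<close> at level \<open>n\<close>: the bounded part has variance of order
  \<open>n\<^sup>1\<^sup>/\<^sup>3\<^sup>-\<^sup>1\<close>, since summands over sets meeting only in \<open>i\<close> are orthogonal, and the tail has first
  moment of order \<open>n\<^sup>-\<^sup>2\<^sup>/\<^sup>3\<close>, which suffices because the Euclidean norm of a vector is at most the sum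
  of its absolute entries.
  For the second, convergence of the characteristic functions gives \<open>n (1 - Re \<phi>(1 / B\<^sub>n)) = O(1)\<close> with
  \<open>B\<^sub>n = n\<^sup>1\<^sup>/\<^sup>2 \<ell>(n)\<close>, hence a bound on the second moment truncated at \<open>B\<^sub>n\<close>.\<close>

section \<open>Sums over subsets\<close>

text \<open>Neither \<open>h\<close> nor \<open>h1\<close> need be square integrable, so a variance
  decomposition of \<open>h\<close> and a law of large numbers for the squares of \<open>h1\<close>
  are both out of reach. The second is avoided because two random sums are compared: tightness of
  one and smallness of their difference suffice. The first is repaired by truncation, each piece
  being centred at its own projection. Truncation at n^a would leave error bounds of order n^(a/3 -
  1) and n^(1/2 - 2a/3), which both vanish for 3/4 < a < 3; the level n is a convenient choice. The
  residuals are controlled relative to n, not to n times the squared factor. Passing to the latter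
  costs only a positive lower bound on \<open>L\<close>, which holds whether the variance is finite
  or infinite. A second moment truncated at B_n does not yet give tightness of the sum of squares,
  since some of the n observations may exceed B_n with a probability that does not tend to 0.
  Truncating at the level of a sample 2^j times as large, with j fixed, lowers this probability to
  order 2^-j, while slow variation keeps the growth of the moment bounded.\<close>

lemma strict_mono_on_eq_sorted_list:
  fixes j :: "nat \<Rightarrow> nat"
  assumes "strict_mono_on {..<m} j"
  shows "map j [0..<m] = sorted_list_of_set (j ` {..<m})"
proof -
  have "sorted_wrt (<) (map j [0..<m])"
    using assms by (auto simp: sorted_wrt_iff_nth_less strict_mono_on_def)
  moreover have "set (map j [0..<m]) = j ` {..<m}"
    by (auto simp: lessThan_atLeast0)
  ultimately show ?thesis
    using sorted_list_of_set.idem_if_sorted_distinct[of "map j [0..<m]"]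
    by (simp add: strict_sorted_iff)
qed

text \<open>Lets sums over increasing tuples be handled as sums over subsets, where deleting an
  index and counting overlaps are set operations. The inverse is the sorted enumeration.\<close>

lemma bij_betw_increasing_tuples:
  assumes "finite A"
  shows "bij_betw (\<lambda>j. j ` {..<m}) (increasing_tuples m A) {J. J \<subseteq> A \<and> card J = m}"
proof (rule bij_betw_byWitness[where f' = "\<lambda>J. \<lambda>k\<in>{..<m}. sorted_list_of_set J ! k"])
  show "\<forall>j\<in>increasing_tuples m A. (\<lambda>k\<in>{..<m}. sorted_list_of_set (j ` {..<m}) ! k) = j"
  proof
    fix j assume "j \<in> increasing_tuples m A"
    then have j: "j \<in> {..<m} \<rightarrow>\<^sub>E A" "strict_mono_on {..<m} j"
      by (auto simp: increasing_tuples_def)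
    show "(\<lambda>k\<in>{..<m}. sorted_list_of_set (j ` {..<m}) ! k) = j"
    proof
      fix k
      \<comment> \<open>Tuples are extensional, so the two functions must agree outside
        \<open>{..<m}\<close> as well.\<close>
      have "j k = undefined" if "\<not> k < m"
        using PiE_arb[OF j(1)] that by simp
      then show "(\<lambda>k\<in>{..<m}. sorted_list_of_set (j ` {..<m}) ! k) k = j k"
        unfolding strict_mono_on_eq_sorted_list[OF j(2), symmetric] by simp
    qed
  qed
  have img: "(\<lambda>k\<in>{..<m}. sorted_list_of_set J ! k) ` {..<m} = J" if "J \<subseteq> A" "card J = m" for J
  proof -
    have "finite J" using that assms finite_subset by blast
    then have "J = set (sorted_list_of_set J)" by simp
    also have "\<dots> = (\<lambda>k. sorted_list_of_set J ! k) ` {..<m}"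
      unfolding set_conv_nth using that(2) by (auto simp del: set_sorted_list_of_set)
    finally show ?thesis by simp
  qed
  show "\<forall>J\<in>{J. J \<subseteq> A \<and> card J = m}. (\<lambda>k\<in>{..<m}. sorted_list_of_set J ! k) ` {..<m} = J"
    using img by blast
  show "(\<lambda>j. j ` {..<m}) ` increasing_tuples m A \<subseteq> {J. J \<subseteq> A \<and> card J = m}"
    by (force simp: increasing_tuples_def card_image strict_mono_on_imp_inj_on)
  show "(\<lambda>J. \<lambda>k\<in>{..<m}. sorted_list_of_set J ! k) ` {J. J \<subseteq> A \<and> card J = m} \<subseteq> increasing_tuples m A"
  proof safe
    fix J assume J: "J \<subseteq> A" "m = card J"
    then have "finite J" using assms finite_subset by blast
    then have "sorted_wrt (<) (sorted_list_of_set J)" by simp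
    with \<open>finite J\<close> have "strict_mono_on {..<card J} (\<lambda>k\<in>{..<card J}. sorted_list_of_set J ! k)"
      by (auto simp: sorted_wrt_iff_nth_less strict_mono_on_def)
    moreover have "(\<lambda>k\<in>{..<card J}. sorted_list_of_set J ! k) \<in> {..<card J} \<rightarrow>\<^sub>E A"
      using img[of J] J by (intro PiE_I) auto
    ultimately show "(\<lambda>k\<in>{..<card J}. sorted_list_of_set J ! k) \<in> increasing_tuples (card J) A"
      by (simp add: increasing_tuples_def)
  qed
qed

text \<open>The sorted order is only a canonical choice: for a symmetric kernel every enumeration
  gives the same value. Meant for sets of cardinality \<open>m\<close>, so that \<open>!\<close>
  stays in range.\<close>

definition set_kernel :: "nat \<Rightarrow> ((nat \<Rightarrow> real) \<Rightarrow> real) \<Rightarrow> (nat \<Rightarrow> real) \<Rightarrow> nat set \<Rightarrow> real" where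
  "set_kernel m h x J = h (\<lambda>k\<in>{..<m}. x (sorted_list_of_set J ! k))"

text \<open>Two enumerations of the same set differ by a permutation of the positions, which a
  symmetric kernel does not see.\<close>

lemma set_kernel_bij:
  assumes sym: "symmetric_kernel m h" and e: "bij_betw e {..<m} J"
  shows "set_kernel m h x J = h (\<lambda>k\<in>{..<m}. x (e k))"
proof -
  have fin: "finite J" and card: "card J = m"
    using bij_betw_finite[OF e] bij_betw_same_card[OF e] by auto
  define s where "s = (\<lambda>k. sorted_list_of_set J ! k)"
  have s: "bij_betw s {..<m} J"
    unfolding s_def using bij_betw_nth[of "sorted_list_of_set J" "{..<m}" J] fin card
    by (simp add: lessThan_atLeast0)
  \<comment> \<open>The inverse of \<open>e\<close> after the sorted enumeration \<open>s\<close>,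
    extended by the identity because \<open>permutes\<close> demands it.\<close>
  define p where "p = (\<lambda>k. if k < m then the_inv_into {..<m} e (s k) else k)"
  have bp: "bij_betw (the_inv_into {..<m} e \<circ> s) {..<m} {..<m}"
    using bij_betw_trans[OF s bij_betw_the_inv_into[OF e]] .
  then have "bij_betw p {..<m} {..<m}"
    by (rule bij_betw_cong[THEN iffD1, rotated]) (simp add: p_def)
  then have p: "p permutes {..<m}"
    by (intro bij_imp_permutes) (auto simp: p_def)
  have ep: "e (p k) = s k" if "k < m" for k
  proof -
    have "s k \<in> J" using s that by (auto simp: bij_betw_def)
    then show ?thesis using e that by (auto simp: p_def bij_betw_def f_the_inv_into_f)
  qed
  have pm: "p k < m" if "k < m" for k
    using p that permutes_in_image by fastforce
  have "h (\<lambda>k\<in>{..<m}. (\<lambda>k\<in>{..<m}. x (e k)) (p k)) = h (\<lambda>k\<in>{..<m}. x (e k))"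
    using sym p unfolding symmetric_kernel_def by (meson restrict_PiE_iff UNIV_I)
  moreover have "(\<lambda>k\<in>{..<m}. (\<lambda>k\<in>{..<m}. x (e k)) (p k)) = (\<lambda>k\<in>{..<m}. x (s k))"
    by (auto simp: fun_eq_iff ep pm)
  ultimately show ?thesis by (simp add: set_kernel_def s_def)
qed

lemma sum_increasing_tuples:
  assumes "symmetric_kernel m h" "finite A"
  shows "(\<Sum>j\<in>increasing_tuples m A. h (\<lambda>k\<in>{..<m}. x (j k)))
    = (\<Sum>J | J \<subseteq> A \<and> card J = m. set_kernel m h x J)"
proof -
  have "h (\<lambda>k\<in>{..<m}. x (j k)) = set_kernel m h x (j ` {..<m})"
    if "j \<in> increasing_tuples m A" for j
    using that by (intro set_kernel_bij[OF assms(1), symmetric])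
      (auto simp: increasing_tuples_def bij_betw_def strict_mono_on_imp_inj_on)
  then have "(\<Sum>j\<in>increasing_tuples m A. h (\<lambda>k\<in>{..<m}. x (j k)))
      = (\<Sum>j\<in>increasing_tuples m A. set_kernel m h x (j ` {..<m}))"
    by (intro sum.cong) auto
  also have "\<dots> = (\<Sum>J | J \<subseteq> A \<and> card J = m. set_kernel m h x J)"
    by (rule sum.reindex_bij_betw[OF bij_betw_increasing_tuples[OF assms(2)]])
  finally show ?thesis .
qed

lemma sum_subsets_containing:
  fixes H :: "'b set \<Rightarrow> 'c::comm_monoid_add"
  assumes "finite B" "i \<in> B" "m \<ge> 1"
  shows "(\<Sum>J | J \<subseteq> B \<and> card J = m \<and> i \<in> J. H J)
    = (\<Sum>A | A \<subseteq> B - {i} \<and> card A = m - 1. H (insert i A))"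
proof (rule sum.reindex_bij_witness[where i = "insert i" and j = "\<lambda>J. J - {i}"])
  fix J assume "J \<in> {J. J \<subseteq> B \<and> card J = m \<and> i \<in> J}"
  then show "insert i (J - {i}) = J" "J - {i} \<in> {A. A \<subseteq> B - {i} \<and> card A = m - 1}"
    "H (insert i (J - {i})) = H J"
    by (auto simp: insert_absorb)
next
  fix A assume "A \<in> {A. A \<subseteq> B - {i} \<and> card A = m - 1}"
  moreover from this have "finite A" using assms(1) finite_subset by fastforce
  ultimately show "insert i A - {i} = A" "insert i A \<in> {J. J \<subseteq> B \<and> card J = m \<and> i \<in> J}"
    using assms by (auto simp: card_insert_if subset_iff)
qed

text \<open>Summation runs over the \<open>m - 1\<close> companions of \<open>i\<close> rather than
  over the sets containing \<open>i\<close>: the companions form a block independent of the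
  observation \<open>i\<close>.\<close>

definition local_mean :: "nat \<Rightarrow> ((nat \<Rightarrow> real) \<Rightarrow> real) \<Rightarrow> (nat \<Rightarrow> real) \<Rightarrow> nat \<Rightarrow> nat \<Rightarrow> real" where
  "local_mean m h x n i = (\<Sum>A | A \<subseteq> {..<n} - {i} \<and> card A = m - 1. set_kernel m h x (insert i A))
     / real ((n - 1) choose (m - 1))"

text \<open>Double counting: every \<open>m\<close>-set contains \<open>m\<close> indices, so the
  sums \<open>T i\<close> add up to \<open>m\<close> times the full sum \<open>S\<close>, and
  deleting \<open>i\<close> leaves \<open>S - T i\<close>.\<close>

lemma U_stat_eq_mean:
  assumes sym: "symmetric_kernel m h" and m: "1 \<le> m" "m < n"
  shows "real n * U_stat m h x n = (\<Sum>i<n. local_mean m h x n i)"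
    and "\<And>i. i < n \<Longrightarrow> U_jack m h x n i - U_stat m h x n
      = real m / real (n - m) * (U_stat m h x n - local_mean m h x n i)"
proof -
  define H where "H = set_kernel m h x"
  define S where "S = (\<Sum>J | J \<subseteq> {..<n} \<and> card J = m. H J)"
  define T where "T i = (\<Sum>J | J \<subseteq> {..<n} \<and> card J = m \<and> i \<in> J. H J)" for i
  define c where "c = real ((n - 1) choose (m - 1))"
  obtain n' where n': "n = Suc n'" using m by (cases n) auto
  obtain m' where m': "m = Suc m'" using m by (cases m) auto
  have c0: "c > 0" using m unfolding c_def n' m' by (simp add: zero_less_binomial)
  have fin: "finite {J. J \<subseteq> {..<n} \<and> card J = m}"
    by (rule finite_subset[of _ "Pow {..<n}"]) auto
  have lm: "local_mean m h x n i = T i / c" if "i < n" for i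
    using sum_subsets_containing[of "{..<n}" i m H] that m
    by (simp add: local_mean_def T_def c_def H_def)
  \<comment> \<open>Absorption identity for binomial coefficients; it makes the normalisations of
    the local and the global average compatible.\<close>
  have nm: "real n * c = real m * real (n choose m)"
    using arg_cong[OF Suc_times_binomial_eq[of n' m'], of real] unfolding c_def n' m'
    by (simp only: of_nat_mult diff_Suc_1 mult.commute)
  have C0: "real (n choose m) > 0" using m by (simp add: zero_less_binomial)
  have US: "U_stat m h x n = S / real (n choose m)"
    unfolding U_stat_def sum_increasing_tuples[OF sym finite_lessThan] S_def H_def
    by (simp add: divide_inverse)
  have "(\<Sum>i<n. T i) = (\<Sum>i<n. \<Sum>J | J \<subseteq> {..<n} \<and> card J = m. if i \<in> J then H J else 0)"
  proof (intro sum.cong refl)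
    fix i
    show "T i = (\<Sum>J | J \<subseteq> {..<n} \<and> card J = m. if i \<in> J then H J else 0)"
      unfolding sum.inter_filter[OF fin, symmetric] T_def by (intro sum.cong) auto
  qed
  also have "\<dots> = (\<Sum>J | J \<subseteq> {..<n} \<and> card J = m. \<Sum>i<n. if i \<in> J then H J else 0)"
    by (rule sum.swap)
  also have "\<dots> = (\<Sum>J | J \<subseteq> {..<n} \<and> card J = m. real m * H J)"
  proof (intro sum.cong refl)
    fix J assume "J \<in> {J. J \<subseteq> {..<n} \<and> card J = m}"
    then have "{i \<in> {..<n}. i \<in> J} = J" "card J = m" by auto
    then show "(\<Sum>i<n. if i \<in> J then H J else 0) = real m * H J"
      by (simp add: sum.inter_filter[symmetric])
  qed
  also have "\<dots> = real m * S" by (simp add: S_def sum_distrib_left)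
  finally have sumT: "(\<Sum>i<n. T i) = real m * S" .
  have "(\<Sum>i<n. local_mean m h x n i) = (\<Sum>i<n. T i / c)"
    by (intro sum.cong) (auto simp: lm)
  also have "\<dots> = real m * S / c" by (simp add: sum_divide_distrib[symmetric] sumT)
  also have "\<dots> = real n * (S / real (n choose m))"
    using nm c0 C0 by (simp add: frac_eq_eq mult_ac)
  finally show "real n * U_stat m h x n = (\<Sum>i<n. local_mean m h x n i)"
    by (simp add: US)
  fix i assume i: "i < n"
  have split: "S = (\<Sum>J | J \<subseteq> {..<n} - {i} \<and> card J = m. H J) + T i"
    unfolding S_def T_def
    by (subst sum.union_disjoint[symmetric])
       (auto intro!: sum.cong finite_subset[of _ "Pow {..<n}"])
  have "real n * real ((n - 1) choose m) = real (n - m) * real (n choose m)"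
    using arg_cong[OF binomial_absorb_comp[of n m], of real]
    by (simp add: del: of_nat_diff)
  moreover have nm0: "real (n - m) > 0" "real n > 0" using m by auto
  ultimately have C1: "real ((n - 1) choose m) = real (n - m) * real (n choose m) / real n"
    by (simp add: field_simps)
  have c': "c = real m * real (n choose m) / real n"
    using nm nm0 by (simp add: field_simps)
  have "U_jack m h x n i = (S - T i) / real ((n - 1) choose m)"
    unfolding U_jack_def using sum_increasing_tuples[OF sym, of "{..<n} - {i}" x] split
    by (simp add: H_def divide_inverse)
  also have "\<dots> = real n * (S - T i) / (real (n - m) * real (n choose m))"
    unfolding C1 by simp
  also have "\<dots> - S / real (n choose m) =
      real m / real (n - m) * (S / real (n choose m) - T i / c)"
  proof -
    \<comment> \<open>The identity with D = n - m, K = \<open>n choose m\<close> and \<mu> = m,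
      stated for free real variables so that binomials and natural subtraction stay out of the
      simplification.\<close>
    have *: "(D + \<mu>) * (s - t) / (D * K) - s / K = \<mu> / D * (s / K - t / (\<mu> * K / (D + \<mu>)))"
      if "D > 0" "K > 0" "\<mu> > 0" for D K \<mu> s t :: real
    proof -
      have "(D + \<mu>) * (s - t) / (D * K) - s / K = (\<mu> * s - (D + \<mu>) * t) / (D * K)"
        using that by (simp add: divide_simps) (simp add: algebra_simps)
      moreover have "\<mu> / D * (s / K - t / (\<mu> * K / (D + \<mu>))) = (\<mu> * s - (D + \<mu>) * t) / (D * K)"
        using that by (simp add: divide_simps)
      ultimately show ?thesis by simp
    qed
    have "real n = real (n - m) + real m" using m by simp
    then show ?thesis unfolding c' using *[of "real (n - m)" "real (n choose m)" "real m" S "T i"] nm0 C0 m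
      by simp
  qed
  finally show "U_jack m h x n i - U_stat m h x n
      = real m / real (n - m) * (U_stat m h x n - local_mean m h x n i)"
    by (simp add: US lm[OF i])
qed

section \<open>Counting subsets that contain an index or meet a given set\<close>

lemma card_subsets_containing:
  assumes "finite B" "i \<in> B" "k \<ge> 1"
  shows "card {A. A \<subseteq> B \<and> card A = k \<and> i \<in> A} = (card B - 1) choose (k - 1)"
proof -
  have "card {A. A \<subseteq> B \<and> card A = k \<and> i \<in> A} = card {A. A \<subseteq> B - {i} \<and> card A = k - 1}"
    using sum_subsets_containing[OF assms, of "\<lambda>_. 1::nat"] by simp
  also have "\<dots> = (card B - 1) choose (k - 1)"
    using assms by (subst n_subsets) auto
  finally show ?thesis .
qed

text \<open>Union bound over the elements of \<open>A\<close>, then absorption. Among all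
  \<open>k\<close>-subsets, at most the fraction k^2 / \<open>card B\<close> meets \<open>A\<close>;
  this is where the factor 1/n in the variance comes from. The multiplied form avoids division of
  natural numbers.\<close>

lemma card_subsets_meeting:
  assumes "finite B" "A \<subseteq> B" "card A = k"
  shows "card B * card {A'. A' \<subseteq> B \<and> card A' = k \<and> A \<inter> A' \<noteq> {}} \<le> k\<^sup>2 * (card B choose k)"
proof (cases "k = 0")
  case True
  then have "A = {}" using assms finite_subset by fastforce
  then show ?thesis by simp
next
  case False
  have "{A'. A' \<subseteq> B \<and> card A' = k \<and> A \<inter> A' \<noteq> {}} = (\<Union>i\<in>A. {A'. A' \<subseteq> B \<and> card A' = k \<and> i \<in> A'})"
    by auto
  then have "card {A'. A' \<subseteq> B \<and> card A' = k \<and> A \<inter> A' \<noteq> {}}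
      \<le> (\<Sum>i\<in>A. card {A'. A' \<subseteq> B \<and> card A' = k \<and> i \<in> A'})"
    using assms finite_subset[of A B] by (simp add: card_UN_le)
  also have "\<dots> = (\<Sum>i\<in>A. (card B - 1) choose (k - 1))"
    using assms False by (intro sum.cong card_subsets_containing) auto
  also have "\<dots> = k * ((card B - 1) choose (k - 1))" by (simp add: assms)
  finally have "card B * card {A'. A' \<subseteq> B \<and> card A' = k \<and> A \<inter> A' \<noteq> {}}
      \<le> card B * (k * ((card B - 1) choose (k - 1)))"
    by (rule mult_le_mono2)
  also have "\<dots> = k * (card B * ((card B - 1) choose (k - 1)))"
    by (rule mult.left_commute)
  also have "card B * ((card B - 1) choose (k - 1)) = k * (card B choose k)"
    using times_binomial_minus1_eq[of k "card B"] False by simp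
  finally show ?thesis by (simp add: power2_eq_square mult.assoc)
qed

section \<open>Laws of tuples of an i.i.d. sample\<close>

lemma (in finite_measure) markov_strict:
  fixes f :: "'a \<Rightarrow> real"
  assumes "integrable M f" "\<And>\<omega>. 0 \<le> f \<omega>" "0 < c"
  shows "measure M {\<omega> \<in> space M. f \<omega> > c} \<le> (\<integral>\<omega>. f \<omega> \<partial>M) / c"
proof -
  have [measurable]: "f \<in> borel_measurable M" using assms(1) by auto
  have "measure M {\<omega> \<in> space M. f \<omega> > c} \<le> measure M {\<omega> \<in> space M. f \<omega> \<ge> c}"
    by (intro finite_measure_mono) auto
  also have "\<dots> \<le> (\<integral>\<omega>. f \<omega> \<partial>M) / c"
    using assms by (intro integral_Markov_inequality_measure[where A = "space M"]) auto
  finally show ?thesis .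
qed


text \<open>Abstract in the sequence and its law, because it is instantiated twice: with the sample
  itself and with its image under \<open>h1\<close>.\<close>

locale iid_sample = prob_space M for M :: "'a measure" +
  fixes X :: "nat \<Rightarrow> 'a \<Rightarrow> real" and F :: "real measure"
  assumes indep: "indep_vars (\<lambda>_. borel) X UNIV"
    and distr_X: "\<And>i. distr M borel (X i) = F"
begin

lemma measurable_X [measurable]: "X i \<in> borel_measurable M"
  using indep by (auto simp: indep_vars_def)

lemma prob_space_F: "prob_space F"
  using prob_space_distr[of "X 0" borel] by (simp add: distr_X)

lemma sets_F [simp, measurable_cong]: "sets F = sets borel"
  using distr_X[of 0] by (metis sets_distr)

lemma space_F [simp]: "space F = UNIV"
  using distr_X[of 0] by (metis space_distr space_borel)

abbreviation Fpow :: "nat \<Rightarrow> (nat \<Rightarrow> real) measure" where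
  "Fpow k \<equiv> Pi\<^sub>M {..<k} (\<lambda>_. F)"

abbreviation Rpow :: "nat \<Rightarrow> (nat \<Rightarrow> real) measure" where
  "Rpow k \<equiv> Pi\<^sub>M {..<k} (\<lambda>_. borel)"

lemma prob_space_Fpow: "prob_space (Fpow k)"
  by (intro prob_space_PiM prob_space_F)

lemma sets_Fpow [simp, measurable_cong]: "sets (Fpow k) = sets (Rpow k)"
  by (intro sets_PiM_cong) auto

text \<open>The block is listed in increasing order and reindexed from 0, so that all blocks of one
  size take values in the same space \<open>Rpow k\<close>.\<close>

definition tup :: "nat set \<Rightarrow> 'a \<Rightarrow> nat \<Rightarrow> real" where
  "tup A \<omega> = (\<lambda>k\<in>{..<card A}. X (sorted_list_of_set A ! k) \<omega>)"

lemma measurable_tup [measurable (raw)]: "card A = k \<Longrightarrow> tup A \<in> M \<rightarrow>\<^sub>M Rpow k"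
  unfolding tup_def by (auto intro: measurable_restrict)

text \<open>The whole sequence has the infinite product law, and reindexing a product of equal
  factors along an injection, here the sorted enumeration, gives a product again.\<close>

lemma distr_tup:
  assumes "finite A" "card A = k"
  shows "distr M (Rpow k) (tup A) = Fpow k"
proof -
  have "set (sorted_list_of_set A) = A" "distinct (sorted_list_of_set A)" using assms by auto
  then have inj: "inj_on (\<lambda>k. sorted_list_of_set A ! k) {..<k}"
    using assms by (auto simp: inj_on_def nth_eq_iff_index_eq)
  have U: "distr M (Pi\<^sub>M UNIV (\<lambda>_. borel)) (\<lambda>\<omega>. \<lambda>i\<in>UNIV. X i \<omega>) = Pi\<^sub>M UNIV (\<lambda>_. F)"
    using indep by (subst (asm) indep_vars_iff_distr_eq_PiM) (auto simp: distr_X)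
  have [measurable]: "(\<lambda>\<omega>. \<lambda>i\<in>UNIV. X i \<omega>) \<in> M \<rightarrow>\<^sub>M Pi\<^sub>M UNIV (\<lambda>_. borel)"
    by (rule measurable_restrict) simp
  have [measurable]: "(\<lambda>x. \<lambda>j\<in>{..<k}. x (sorted_list_of_set A ! j)) \<in> Pi\<^sub>M UNIV (\<lambda>_. borel) \<rightarrow>\<^sub>M Rpow k"
    by (intro measurable_restrict measurable_component_singleton) simp
  have "Fpow k = distr (Pi\<^sub>M UNIV (\<lambda>_. F)) (Fpow k) (\<lambda>x. \<lambda>j\<in>{..<k}. x (sorted_list_of_set A ! j))"
    by (rule distr_PiM_reindex[symmetric]) (auto simp: prob_space_F inj)
  also have "\<dots> = distr (Pi\<^sub>M UNIV (\<lambda>_. F)) (Rpow k) (\<lambda>x. \<lambda>j\<in>{..<k}. x (sorted_list_of_set A ! j))"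
    by (intro distr_cong) auto
  also have "\<dots> = distr M (Rpow k) (tup A)"
    unfolding U[symmetric] by (subst distr_distr) (auto simp: comp_def tup_def[abs_def] assms(2))
  finally show ?thesis ..
qed

lemma tup_factor:
  assumes "finite A" "A \<subseteq> B"
  shows "tup A \<omega> = (\<lambda>f. \<lambda>k\<in>{..<card A}. f (sorted_list_of_set A ! k)) (\<lambda>i\<in>B. X i \<omega>)"
proof -
  have "sorted_list_of_set A ! k \<in> B" if "k < card A" for k
    using nth_mem[of k "sorted_list_of_set A"] that assms by auto
  then show ?thesis by (auto simp: tup_def fun_eq_iff)
qed

lemma measurable_tup_factor:
  assumes "finite A" "A \<subseteq> B"
  shows "(\<lambda>f. \<lambda>k\<in>{..<card A}. f (sorted_list_of_set A ! k)) \<in> Pi\<^sub>M B (\<lambda>_. borel) \<rightarrow>\<^sub>M Rpow (card A)"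
proof -
  have "sorted_list_of_set A ! k \<in> B" if "k < card A" for k
    using nth_mem[of k "sorted_list_of_set A"] that assms by auto
  then show ?thesis by (intro measurable_restrict measurable_component_singleton) auto
qed

text \<open>Common source of the product laws for two blocks, for an observation with a block, and
  for an observation with two blocks: measurable functions of disjoint parts of the sample are
  independent.\<close>

lemma distr_blocks:
  assumes AB: "A \<inter> B = {}"
    and f [measurable]: "f \<in> Pi\<^sub>M A (\<lambda>_. borel) \<rightarrow>\<^sub>M S" and g [measurable]: "g \<in> Pi\<^sub>M B (\<lambda>_. borel) \<rightarrow>\<^sub>M T"
  shows "distr M (S \<Otimes>\<^sub>M T) (\<lambda>\<omega>. (f (\<lambda>i\<in>A. X i \<omega>), g (\<lambda>i\<in>B. X i \<omega>)))
    = distr M S (\<lambda>\<omega>. f (\<lambda>i\<in>A. X i \<omega>)) \<Otimes>\<^sub>M distr M T (\<lambda>\<omega>. g (\<lambda>i\<in>B. X i \<omega>))"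
proof -
  define a b where "a = (\<lambda>\<omega>. \<lambda>i\<in>A. X i \<omega>)" and "b = (\<lambda>\<omega>. \<lambda>i\<in>B. X i \<omega>)"
  have "indep_var (Pi\<^sub>M A (\<lambda>_. borel)) a (Pi\<^sub>M B (\<lambda>_. borel)) b"
    unfolding a_def b_def using AB by (intro indep_var_restrict[OF indep]) auto
  then have joint: "distr M (Pi\<^sub>M A (\<lambda>_. borel)) a \<Otimes>\<^sub>M distr M (Pi\<^sub>M B (\<lambda>_. borel)) b
      = distr M (Pi\<^sub>M A (\<lambda>_. borel) \<Otimes>\<^sub>M Pi\<^sub>M B (\<lambda>_. borel)) (\<lambda>\<omega>. (a \<omega>, b \<omega>))"
    and [measurable]: "a \<in> M \<rightarrow>\<^sub>M Pi\<^sub>M A (\<lambda>_. borel)" "b \<in> M \<rightarrow>\<^sub>M Pi\<^sub>M B (\<lambda>_. borel)"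
    by (auto simp: indep_var_distribution_eq)
  have "distr M S (\<lambda>\<omega>. f (a \<omega>)) \<Otimes>\<^sub>M distr M T (\<lambda>\<omega>. g (b \<omega>))
      = distr (distr M (Pi\<^sub>M A (\<lambda>_. borel)) a) S f \<Otimes>\<^sub>M distr (distr M (Pi\<^sub>M B (\<lambda>_. borel)) b) T g"
    by (simp add: distr_distr comp_def)
  also have "\<dots> = distr (distr M (Pi\<^sub>M A (\<lambda>_. borel)) a \<Otimes>\<^sub>M distr M (Pi\<^sub>M B (\<lambda>_. borel)) b) (S \<Otimes>\<^sub>M T)
      (\<lambda>(x, y). (f x, g y))"
    by (rule pair_measure_distr)
      (auto intro!: prob_space_imp_sigma_finite prob_space.prob_space_distr prob_space_axioms)
  also have "\<dots> = distr M (S \<Otimes>\<^sub>M T) (\<lambda>\<omega>. (f (a \<omega>), g (b \<omega>)))"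
    unfolding joint by (subst distr_distr) (auto simp: comp_def)
  finally show ?thesis by (simp add: a_def b_def)
qed

lemma distr_tup_pair:
  assumes "finite A" "finite B" "A \<inter> B = {}" "card A = k" "card B = l"
  shows "distr M (Rpow k \<Otimes>\<^sub>M Rpow l) (\<lambda>\<omega>. (tup A \<omega>, tup B \<omega>)) = Fpow k \<Otimes>\<^sub>M Fpow l"
  using distr_blocks[OF assms(3) measurable_tup_factor[OF assms(1) order_refl]
      measurable_tup_factor[OF assms(2) order_refl],
      folded tup_factor[OF assms(1) order_refl] tup_factor[OF assms(2) order_refl]]
    distr_tup assms by simp

lemma distr_X_tup:
  assumes "finite A" "i \<notin> A" "card A = k"
  shows "distr M (borel \<Otimes>\<^sub>M Rpow k) (\<lambda>\<omega>. (X i \<omega>, tup A \<omega>)) = F \<Otimes>\<^sub>M Fpow k"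
  using distr_blocks[of "{i}" A "\<lambda>f. f i" borel, OF _ _ measurable_tup_factor[OF assms(1) order_refl],
      folded tup_factor[OF assms(1) order_refl]]
    distr_tup assms distr_X by simp

lemma distr_X_tup_tup:
  assumes "finite A" "finite B" "A \<inter> B = {}" "i \<notin> A" "i \<notin> B" "card A = k" "card B = k"
  shows "distr M (borel \<Otimes>\<^sub>M (Rpow k \<Otimes>\<^sub>M Rpow k)) (\<lambda>\<omega>. (X i \<omega>, (tup A \<omega>, tup B \<omega>)))
    = F \<Otimes>\<^sub>M (Fpow k \<Otimes>\<^sub>M Fpow k)"
proof -
  define p where "p = (\<lambda>f. ((\<lambda>k\<in>{..<card A}. f (sorted_list_of_set A ! k) :: real),
      (\<lambda>k\<in>{..<card B}. f (sorted_list_of_set B ! k) :: real)))"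
  have p: "p \<in> Pi\<^sub>M (A \<union> B) (\<lambda>_. borel) \<rightarrow>\<^sub>M Rpow k \<Otimes>\<^sub>M Rpow k"
    using measurable_tup_factor[of A "A \<union> B"] measurable_tup_factor[of B "A \<union> B"] assms
    unfolding p_def by (intro measurable_Pair) auto
  have "p (\<lambda>i\<in>A \<union> B. X i \<omega>) = (tup A \<omega>, tup B \<omega>)" for \<omega>
    using tup_factor[of A "A \<union> B" \<omega>] tup_factor[of B "A \<union> B" \<omega>] assms by (simp add: p_def)
  with distr_blocks[of "{i}" "A \<union> B" "\<lambda>f. f i" borel, OF _ _ p] show ?thesis
    using assms by (simp add: distr_X distr_tup_pair)
qed

text \<open>For integrable \<open>u\<close> this is the conditional expectation of \<open>u\<close>
  given its first coordinate. Where a section of \<open>u\<close> is not integrable the value is 0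
  by the convention for the integral, so additivity holds only almost everywhere.\<close>

definition proj1 :: "nat \<Rightarrow> (real \<times> (nat \<Rightarrow> real) \<Rightarrow> real) \<Rightarrow> real \<Rightarrow> real" where
  "proj1 k u x = (\<integral>y. u (x, y) \<partial>Fpow k)"

lemma measurable_proj1 [measurable (raw)]:
  assumes [measurable]: "u \<in> borel_measurable (borel \<Otimes>\<^sub>M Rpow k)"
  shows "proj1 k u \<in> borel_measurable borel"
proof -
  interpret G: prob_space "Fpow k" by (rule prob_space_Fpow)
  show ?thesis unfolding proj1_def[abs_def] by measurable
qed

lemma integral_X_tup:
  fixes u :: "real \<times> (nat \<Rightarrow> real) \<Rightarrow> real"
  assumes "finite A" "i \<notin> A" "card A = k"
    and [measurable]: "u \<in> borel_measurable (borel \<Otimes>\<^sub>M Rpow k)"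
  shows "(\<integral>\<omega>. u (X i \<omega>, tup A \<omega>) \<partial>M) = integral\<^sup>L (F \<Otimes>\<^sub>M Fpow k) u"
    and "integrable M (\<lambda>\<omega>. u (X i \<omega>, tup A \<omega>)) \<longleftrightarrow> integrable (F \<Otimes>\<^sub>M Fpow k) u"
proof -
  have [measurable]: "tup A \<in> M \<rightarrow>\<^sub>M Rpow k" by (rule measurable_tup) fact
  show "(\<integral>\<omega>. u (X i \<omega>, tup A \<omega>) \<partial>M) = integral\<^sup>L (F \<Otimes>\<^sub>M Fpow k) u"
    unfolding distr_X_tup[OF assms(1-3), symmetric] by (subst integral_distr) auto
  show "integrable M (\<lambda>\<omega>. u (X i \<omega>, tup A \<omega>)) \<longleftrightarrow> integrable (F \<Otimes>\<^sub>M Fpow k) u"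
    unfolding distr_X_tup[OF assms(1-3), symmetric] by (subst integrable_distr_eq) auto
qed

lemma proj1_bounded:
  assumes u: "u \<in> borel_measurable (borel \<Otimes>\<^sub>M Rpow k)" "\<And>z. \<bar>u z\<bar> \<le> B"
  shows "\<bar>proj1 k u x\<bar> \<le> B"
proof -
  interpret G: prob_space "Fpow k" by (rule prob_space_Fpow)
  note [measurable] = u(1)
  have int: "integrable (Fpow k) (\<lambda>y. u (x, y))"
    using u(2) by (intro G.integrable_const_bound[of _ B]) auto
  have "\<bar>proj1 k u x\<bar> \<le> (\<integral>y. \<bar>u (x, y)\<bar> \<partial>Fpow k)"
    unfolding proj1_def by (rule integral_abs_bound)
  also have "\<dots> \<le> (\<integral>y. B \<partial>Fpow k)"
    using int u(2) by (intro integral_mono) auto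
  finally show ?thesis by (simp add: G.prob_space)
qed

text \<open>Given the common observation, the two blocks are independent and each residual has mean
  0. Boundedness of \<open>u\<close> is what makes the products integrable and Fubini
  applicable.\<close>

lemma residual_orthogonal:
  assumes u: "u \<in> borel_measurable (borel \<Otimes>\<^sub>M Rpow k)" "\<And>z. \<bar>u z\<bar> \<le> B"
    and AB: "finite A" "finite A'" "A \<inter> A' = {}" "i \<notin> A" "i \<notin> A'" "card A = k" "card A' = k"
  shows "(\<integral>\<omega>. (u (X i \<omega>, tup A \<omega>) - proj1 k u (X i \<omega>)) * (u (X i \<omega>, tup A' \<omega>) - proj1 k u (X i \<omega>)) \<partial>M) = 0"
proof -
  interpret G: prob_space "Fpow k" by (rule prob_space_Fpow)
  interpret F: prob_space F by (rule prob_space_F)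
  interpret GG: pair_prob_space "Fpow k" "Fpow k" ..
  interpret FGG: pair_prob_space F "Fpow k \<Otimes>\<^sub>M Fpow k" ..
  note [measurable] = u(1) measurable_proj1[OF u(1)] measurable_tup[OF AB(6)] measurable_tup[OF AB(7)]
  define v where "v x y = u (x, y) - proj1 k u x" for x y
  have [measurable]: "case_prod v \<in> borel_measurable (borel \<Otimes>\<^sub>M Rpow k)"
    unfolding v_def by measurable
  have bound: "\<bar>v x y\<bar> \<le> 2 * B" for x y
    unfolding v_def using u(2)[of "(x, y)"] proj1_bounded[OF u, of x] by linarith
  have B0: "0 \<le> B" using u(2)[of undefined] by linarith
  have bound2: "\<bar>v x y * v x z\<bar> \<le> 2 * B * (2 * B)" for x y z
    unfolding abs_mult using bound B0 by (intro mult_mono) auto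
  have int: "integrable (Fpow k) (\<lambda>y. u (x, y))" for x
    using u(2) by (intro G.integrable_const_bound[of _ B]) auto
  have v0: "(\<integral>y. v x y \<partial>Fpow k) = 0" for x
    using int[of x] by (simp add: v_def proj1_def G.prob_space)
  have inner: "(\<integral>p. v x (fst p) * v x (snd p) \<partial>(Fpow k \<Otimes>\<^sub>M Fpow k)) = 0" for x
  proof -
    have "integrable (Fpow k \<Otimes>\<^sub>M Fpow k) (\<lambda>p. v x (fst p) * v x (snd p))"
      using bound2 by (intro GG.P.integrable_const_bound[of _ "2 * B * (2 * B)"]) auto
    from GG.integral_fst'[OF this, symmetric] show ?thesis by (simp add: v0)
  qed
  have "(\<integral>\<omega>. v (X i \<omega>) (tup A \<omega>) * v (X i \<omega>) (tup A' \<omega>) \<partial>M)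
      = (\<integral>t. v (fst t) (fst (snd t)) * v (fst t) (snd (snd t)) \<partial>(F \<Otimes>\<^sub>M (Fpow k \<Otimes>\<^sub>M Fpow k)))"
    unfolding distr_X_tup_tup[OF AB, symmetric] by (subst integral_distr) auto
  also have "\<dots> = (\<integral>x. (\<integral>p. v x (fst p) * v x (snd p) \<partial>(Fpow k \<Otimes>\<^sub>M Fpow k)) \<partial>F)"
  proof -
    have "integrable (F \<Otimes>\<^sub>M (Fpow k \<Otimes>\<^sub>M Fpow k)) (\<lambda>t. v (fst t) (fst (snd t)) * v (fst t) (snd (snd t)))"
      using bound2 by (intro FGG.P.integrable_const_bound[of _ "2 * B * (2 * B)"]) auto
    from FGG.integral_fst'[OF this, symmetric] show ?thesis by simp
  qed
  also have "\<dots> = 0" by (simp add: inner)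
  finally show ?thesis by (simp add: v_def)
qed

end

section \<open>Moments of local averages\<close>

context iid_sample
begin

text \<open>Fubini; the third claim is the contraction of the absolute first moment under
  conditioning.\<close>

lemma integral_proj1:
  assumes u [measurable]: "u \<in> borel_measurable (borel \<Otimes>\<^sub>M Rpow k)"
    and int: "integrable (F \<Otimes>\<^sub>M Fpow k) u"
  shows "integrable M (\<lambda>\<omega>. proj1 k u (X i \<omega>))"
    and "(\<integral>\<omega>. proj1 k u (X i \<omega>) \<partial>M) = integral\<^sup>L (F \<Otimes>\<^sub>M Fpow k) u"
    and "(\<integral>\<omega>. \<bar>proj1 k u (X i \<omega>)\<bar> \<partial>M) \<le> (\<integral>z. \<bar>u z\<bar> \<partial>(F \<Otimes>\<^sub>M Fpow k))"
proof -
  interpret G: prob_space "Fpow k" by (rule prob_space_Fpow)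
  interpret F: prob_space F by (rule prob_space_F)
  interpret FG: pair_prob_space F "Fpow k" ..
  have i1: "integrable F (proj1 k u)"
    using FG.integrable_fst'[OF int] by (simp add: proj1_def[abs_def])
  then show i2: "integrable M (\<lambda>\<omega>. proj1 k u (X i \<omega>))"
    using integrable_distr_eq[of "X i" M borel "proj1 k u"] by (simp add: distr_X)
  have *: "(\<integral>\<omega>. f (X i \<omega>) \<partial>M) = (\<integral>x. f x \<partial>F)" if "f \<in> borel_measurable borel" for f :: "real \<Rightarrow> real"
    unfolding distr_X[of i, symmetric] using that by (subst integral_distr) auto
  show "(\<integral>\<omega>. proj1 k u (X i \<omega>) \<partial>M) = integral\<^sup>L (F \<Otimes>\<^sub>M Fpow k) u"
    using FG.integral_fst'[OF int] by (subst *) (auto simp: proj1_def[abs_def])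
  have ia: "integrable (F \<Otimes>\<^sub>M Fpow k) (\<lambda>z. \<bar>u z\<bar>)" using int by simp
  have "(\<integral>\<omega>. \<bar>proj1 k u (X i \<omega>)\<bar> \<partial>M) = (\<integral>x. \<bar>proj1 k u x\<bar> \<partial>F)"
    by (subst *) auto
  also have "\<dots> \<le> (\<integral>x. (\<integral>y. \<bar>u (x, y)\<bar> \<partial>Fpow k) \<partial>F)"
    using i1 FG.integrable_fst'[OF ia] unfolding proj1_def
    by (intro integral_mono integral_abs_bound) auto
  also have "\<dots> = (\<integral>z. \<bar>u z\<bar> \<partial>(F \<Otimes>\<^sub>M Fpow k))"
    using FG.integral_fst'[OF ia] by simp
  finally show "(\<integral>\<omega>. \<bar>proj1 k u (X i \<omega>)\<bar> \<partial>M) \<le> (\<integral>z. \<bar>u z\<bar> \<partial>(F \<Otimes>\<^sub>M Fpow k))" .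
qed

definition others :: "nat \<Rightarrow> nat \<Rightarrow> nat \<Rightarrow> nat set set" where
  "others n i k = {A. A \<subseteq> {..<n} - {i} \<and> card A = k}"

lemma othersD: "A \<in> others n i k \<Longrightarrow> finite A \<and> i \<notin> A \<and> card A = k"
  using finite_subset[of A "{..<n} - {i}"] by (auto simp: others_def)

lemma finite_others [simp]: "finite (others n i k)"
  unfolding others_def by (rule finite_subset[of _ "Pow {..<n}"]) auto

lemma card_others: "i < n \<Longrightarrow> card (others n i k) = (n - 1) choose k"
  unfolding others_def by (subst n_subsets) auto

text \<open>For each value of the first coordinate the inner integral is a variance, hence at most
  the second moment of the section.\<close>

lemma residual_second_moment:
  assumes u: "u \<in> borel_measurable (borel \<Otimes>\<^sub>M Rpow k)" "\<And>z. \<bar>u z\<bar> \<le> B"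
    and A: "finite A" "i \<notin> A" "card A = k"
  shows "(\<integral>\<omega>. (u (X i \<omega>, tup A \<omega>) - proj1 k u (X i \<omega>))\<^sup>2 \<partial>M) \<le> (\<integral>z. (u z)\<^sup>2 \<partial>(F \<Otimes>\<^sub>M Fpow k))"
proof -
  interpret G: prob_space "Fpow k" by (rule prob_space_Fpow)
  interpret F: prob_space F by (rule prob_space_F)
  interpret FG: pair_prob_space F "Fpow k" ..
  note [measurable] = u(1) measurable_proj1[OF u(1)]
  define v where "v z = (u z - proj1 k u (fst z))\<^sup>2" for z
  have [measurable]: "v \<in> borel_measurable (borel \<Otimes>\<^sub>M Rpow k)" unfolding v_def by measurable
  have B0: "0 \<le> B" using u(2)[of undefined] by linarith
  have v_bound: "\<bar>v z\<bar> \<le> (2 * B)\<^sup>2" for z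
  proof -
    have "\<bar>u z - proj1 k u (fst z)\<bar> \<le> \<bar>2 * B\<bar>"
      using u(2)[of z] proj1_bounded[OF u, of "fst z"] B0 by linarith
    then show ?thesis unfolding v_def by (simp only: abs_le_square_iff abs_power2)
  qed
  have u2_bound: "\<bar>(u z)\<^sup>2\<bar> \<le> B\<^sup>2" for z
    using u(2)[of z] B0 by (simp add: abs_le_square_iff[symmetric])
  have iv: "integrable (F \<Otimes>\<^sub>M Fpow k) v"
    using v_bound by (intro FG.P.integrable_const_bound[of _ "(2 * B)\<^sup>2"]) auto
  have iu: "integrable (F \<Otimes>\<^sub>M Fpow k) (\<lambda>z. (u z)\<^sup>2)"
    using u2_bound by (intro FG.P.integrable_const_bound[of _ "B\<^sup>2"]) auto
  have "(\<integral>\<omega>. (u (X i \<omega>, tup A \<omega>) - proj1 k u (X i \<omega>))\<^sup>2 \<partial>M) = integral\<^sup>L (F \<Otimes>\<^sub>M Fpow k) v"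
    using integral_X_tup(1)[OF A, of v] by (simp add: v_def)
  also have "\<dots> = (\<integral>x. (\<integral>y. v (x, y) \<partial>Fpow k) \<partial>F)"
    using FG.integral_fst'[OF iv] by simp
  also have "\<dots> \<le> (\<integral>x. (\<integral>y. (u (x, y))\<^sup>2 \<partial>Fpow k) \<partial>F)"
  proof (rule integral_mono)
    show "integrable F (\<lambda>x. \<integral>y. v (x, y) \<partial>Fpow k)" using FG.integrable_fst'[OF iv] by simp
    show "integrable F (\<lambda>x. \<integral>y. (u (x, y))\<^sup>2 \<partial>Fpow k)" using FG.integrable_fst'[OF iu] by simp
    fix x
    have "(\<integral>y. v (x, y) \<partial>Fpow k) = (\<integral>y. (u (x, y))\<^sup>2 \<partial>Fpow k) - (proj1 k u x)\<^sup>2"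
    proof -
      have "integrable (Fpow k) (\<lambda>y. u (x, y))"
        using u(2) by (intro G.integrable_const_bound[of _ B]) auto
      moreover have "integrable (Fpow k) (\<lambda>y. (u (x, y))\<^sup>2)"
        using u2_bound by (intro G.integrable_const_bound[of _ "B\<^sup>2"]) auto
      ultimately show ?thesis
        using G.variance_eq[of "\<lambda>y. u (x, y)"] by (simp add: v_def proj1_def)
    qed
    then show "(\<integral>y. v (x, y) \<partial>Fpow k) \<le> (\<integral>y. (u (x, y))\<^sup>2 \<partial>Fpow k)" by simp
  qed
  also have "\<dots> = (\<integral>z. (u z)\<^sup>2 \<partial>(F \<Otimes>\<^sub>M Fpow k))"
    using FG.integral_fst'[OF iu] by simp
  finally show ?thesis .
qed

text \<open>The local average as a random variable, for a kernel whose first argument is split off.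
  It is defined for any such function, so that the truncated pieces of the kernel can be averaged as
  well.\<close>

definition loc_avg :: "nat \<Rightarrow> (real \<times> (nat \<Rightarrow> real) \<Rightarrow> real) \<Rightarrow> nat \<Rightarrow> nat \<Rightarrow> 'a \<Rightarrow> real" where
  "loc_avg k u n i \<omega> = (\<Sum>A\<in>others n i k. u (X i \<omega>, tup A \<omega>)) / real ((n - 1) choose k)"

lemma measurable_X_tup [measurable (raw)]:
  assumes [measurable]: "u \<in> borel_measurable (borel \<Otimes>\<^sub>M Rpow k)" and "card A = k"
  shows "(\<lambda>\<omega>. u (X i \<omega>, tup A \<omega>)) \<in> borel_measurable M"
proof -
  have [measurable]: "tup A \<in> M \<rightarrow>\<^sub>M Rpow k" using assms(2) by (rule measurable_tup)
  show ?thesis by measurable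
qed

lemma measurable_loc_avg [measurable (raw)]:
  assumes "u \<in> borel_measurable (borel \<Otimes>\<^sub>M Rpow k)"
  shows "loc_avg k u n i \<in> borel_measurable M"
  unfolding loc_avg_def[abs_def]
  using assms by (intro borel_measurable_divide borel_measurable_sum measurable_X_tup) (auto dest: othersD)

text \<open>Expanding the square gives a double sum over blocks. Disjoint pairs contribute 0, and
  the pairs that meet are at most the fraction k^2 / (n - 1) of all pairs, each contributing at most
  the second moment of \<open>u\<close>. For \<open>k = 0\<close> no pair meets and the bound is
  0.\<close>

lemma loc_avg_variance:
  assumes u: "u \<in> borel_measurable (borel \<Otimes>\<^sub>M Rpow k)" "\<And>z. \<bar>u z\<bar> \<le> B"
    and n: "i < n" "1 < n" "k < n"
  shows "integrable M (\<lambda>\<omega>. (loc_avg k u n i \<omega> - proj1 k u (X i \<omega>))\<^sup>2)"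
    and "(\<integral>\<omega>. (loc_avg k u n i \<omega> - proj1 k u (X i \<omega>))\<^sup>2 \<partial>M)
      \<le> real (k\<^sup>2) / real (n - 1) * (\<integral>z. (u z)\<^sup>2 \<partial>(F \<Otimes>\<^sub>M Fpow k))"
proof -
  note [measurable] = u(1) measurable_proj1[OF u(1)]
  define D where "D A \<omega> = u (X i \<omega>, tup A \<omega>) - proj1 k u (X i \<omega>)" for A \<omega>
  define v where "v = (\<integral>z. (u z)\<^sup>2 \<partial>(F \<Otimes>\<^sub>M Fpow k))"
  define N where "N = real ((n - 1) choose k)"
  define T where "T = others n i k"
  have N0: "N > 0" using n unfolding N_def by (simp add: zero_less_binomial)
  have cT: "real (card T) = N" unfolding T_def N_def by (simp add: card_others[OF n(1)])
  have fT [simp]: "finite T" by (simp add: T_def)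
  have v0: "v \<ge> 0" unfolding v_def by simp
  have B0: "0 \<le> B" using u(2)[of undefined] by linarith
  have D_bound: "\<bar>D A \<omega>\<bar> \<le> 2 * B" for A \<omega>
    unfolding D_def using u(2)[of "(X i \<omega>, tup A \<omega>)"] proj1_bounded[OF u, of "X i \<omega>"] by linarith
  have D_meas [measurable]: "D A \<in> borel_measurable M" if "A \<in> T" for A
    using that othersD[of A n i k] measurable_X_tup[OF u(1), of A i] unfolding D_def T_def
    by (intro borel_measurable_diff) auto
  have DD_int: "integrable M (\<lambda>\<omega>. D A \<omega> * D A' \<omega>)" if "A \<in> T" "A' \<in> T" for A A'
  proof (rule integrable_const_bound[of _ "2 * B * (2 * B)"])
    show "AE \<omega> in M. norm (D A \<omega> * D A' \<omega>) \<le> 2 * B * (2 * B)"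
      unfolding real_norm_def abs_mult using D_bound B0 by (intro AE_I2 mult_mono) auto
  qed (use that in measurable)
  have D2: "(\<integral>\<omega>. (D A \<omega>)\<^sup>2 \<partial>M) \<le> v" if "A \<in> T" for A
    using residual_second_moment[OF u, of A i] othersD[of A n i k] that by (simp add: D_def v_def T_def)
  have DD: "(\<integral>\<omega>. D A \<omega> * D A' \<omega> \<partial>M) \<le> (if A \<inter> A' \<noteq> {} then v else 0)"
    if "A \<in> T" "A' \<in> T" for A A'
  proof (cases "A \<inter> A' = {}")
    case True
    then show ?thesis
      using residual_orthogonal[OF u, of A A' i] othersD[of A n i k] othersD[of A' n i k] that
      by (simp add: D_def T_def)
  next
    case False
    \<comment> \<open>No cancellation is available for blocks that meet, so the product is bounded
      by the mean of the two squares.\<close>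
    have "(\<integral>\<omega>. D A \<omega> * D A' \<omega> \<partial>M) \<le> (\<integral>\<omega>. ((D A \<omega>)\<^sup>2 + (D A' \<omega>)\<^sup>2) / 2 \<partial>M)"
    proof (rule integral_mono[OF DD_int[OF that]])
      show "integrable M (\<lambda>\<omega>. ((D A \<omega>)\<^sup>2 + (D A' \<omega>)\<^sup>2) / 2)"
        using DD_int[OF that(1) that(1)] DD_int[OF that(2) that(2)] by (simp add: power2_eq_square)
      show "D A \<omega> * D A' \<omega> \<le> ((D A \<omega>)\<^sup>2 + (D A' \<omega>)\<^sup>2) / 2" for \<omega>
        using sum_squares_bound[of "D A \<omega>" "D A' \<omega>"] by simp
    qed
    also have "\<dots> = ((\<integral>\<omega>. (D A \<omega>)\<^sup>2 \<partial>M) + (\<integral>\<omega>. (D A' \<omega>)\<^sup>2 \<partial>M)) / 2"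
      using DD_int[OF that(1) that(1)] DD_int[OF that(2) that(2)] by (simp add: power2_eq_square)
    also have "\<dots> \<le> v" using D2[OF that(1)] D2[OF that(2)] by simp
    finally show ?thesis using False by simp
  qed
  have eq: "(loc_avg k u n i \<omega> - proj1 k u (X i \<omega>))\<^sup>2 = (\<Sum>A\<in>T. \<Sum>A'\<in>T. D A \<omega> * D A' \<omega>) / N\<^sup>2" for \<omega>
  proof -
    have "(\<Sum>A\<in>T. D A \<omega>) = (\<Sum>A\<in>T. u (X i \<omega>, tup A \<omega>)) - N * proj1 k u (X i \<omega>)"
      unfolding D_def sum_subtractf by (simp add: cT)
    then have "loc_avg k u n i \<omega> - proj1 k u (X i \<omega>) = (\<Sum>A\<in>T. D A \<omega>) / N"
      using N0 by (simp add: loc_avg_def T_def N_def field_simps)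
    then show ?thesis by (simp add: power_divide power2_eq_square sum_product)
  qed
  show "integrable M (\<lambda>\<omega>. (loc_avg k u n i \<omega> - proj1 k u (X i \<omega>))\<^sup>2)"
    unfolding eq by (intro integrable_divide Bochner_Integration.integrable_sum DD_int)
  have "(\<integral>\<omega>. (loc_avg k u n i \<omega> - proj1 k u (X i \<omega>))\<^sup>2 \<partial>M)
      = (\<Sum>A\<in>T. \<Sum>A'\<in>T. (\<integral>\<omega>. D A \<omega> * D A' \<omega> \<partial>M)) / N\<^sup>2"
    unfolding eq using DD_int by (simp add: Bochner_Integration.integral_sum)
  also have "\<dots> \<le> (\<Sum>A\<in>T. real (k\<^sup>2) * N / real (n - 1) * v) / N\<^sup>2"
  proof (intro divide_right_mono sum_mono)
    fix A assume A: "A \<in> T"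
    have "(\<Sum>A'\<in>T. (\<integral>\<omega>. D A \<omega> * D A' \<omega> \<partial>M)) \<le> (\<Sum>A'\<in>T. if A \<inter> A' \<noteq> {} then v else 0)"
      by (intro sum_mono DD A)
    also have "\<dots> = real (card {A' \<in> T. A \<inter> A' \<noteq> {}}) * v"
      by (simp add: sum.inter_filter[symmetric])
    also have "\<dots> \<le> real (k\<^sup>2) * N / real (n - 1) * v"
    proof (intro mult_right_mono v0)
      have "{A' \<in> T. A \<inter> A' \<noteq> {}} = {A'. A' \<subseteq> {..<n} - {i} \<and> card A' = k \<and> A \<inter> A' \<noteq> {}}"
        by (auto simp: T_def others_def)
      moreover have "card ({..<n} - {i}) = n - 1" using n by simp
      ultimately have "(n - 1) * card {A' \<in> T. A \<inter> A' \<noteq> {}} \<le> k\<^sup>2 * ((n - 1) choose k)"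
        using card_subsets_meeting[of "{..<n} - {i}" A k] A by (simp add: T_def others_def)
      then have "real (n - 1) * real (card {A' \<in> T. A \<inter> A' \<noteq> {}}) \<le> real (k\<^sup>2) * N"
        unfolding N_def of_nat_mult[symmetric] of_nat_le_iff .
      then show "real (card {A' \<in> T. A \<inter> A' \<noteq> {}}) \<le> real (k\<^sup>2) * N / real (n - 1)"
        using n by (simp add: le_divide_eq mult.commute)
    qed
    finally show "(\<Sum>A'\<in>T. (\<integral>\<omega>. D A \<omega> * D A' \<omega> \<partial>M)) \<le> real (k\<^sup>2) * N / real (n - 1) * v" .
  qed simp
  also have "\<dots> = real (k\<^sup>2) / real (n - 1) * v"
    using N0 by (simp add: cT power2_eq_square)
  finally show "(\<integral>\<omega>. (loc_avg k u n i \<omega> - proj1 k u (X i \<omega>))\<^sup>2 \<partial>M) \<le> real (k\<^sup>2) / real (n - 1) * v" .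
qed

text \<open>Only the triangle inequality is available without second moments; the factor 2 counts
  the average and its projection.\<close>

lemma loc_avg_abs_moment:
  assumes w: "w \<in> borel_measurable (borel \<Otimes>\<^sub>M Rpow k)" "integrable (F \<Otimes>\<^sub>M Fpow k) w"
    and n: "i < n" "k < n"
  shows "integrable M (\<lambda>\<omega>. \<bar>loc_avg k w n i \<omega> - proj1 k w (X i \<omega>)\<bar>)"
    and "(\<integral>\<omega>. \<bar>loc_avg k w n i \<omega> - proj1 k w (X i \<omega>)\<bar> \<partial>M)
      \<le> 2 * (\<integral>z. \<bar>w z\<bar> \<partial>(F \<Otimes>\<^sub>M Fpow k))"
proof -
  note [measurable] = w(1)
  define v where "v = (\<integral>z. \<bar>w z\<bar> \<partial>(F \<Otimes>\<^sub>M Fpow k))"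
  define N where "N = real ((n - 1) choose k)"
  define T where "T = others n i k"
  have N0: "N > 0" using n unfolding N_def by (simp add: zero_less_binomial)
  have cT: "real (card T) = N" unfolding T_def N_def by (simp add: card_others[OF n(1)])
  have iA: "integrable M (\<lambda>\<omega>. w (X i \<omega>, tup A \<omega>))" if "A \<in> T" for A
    using integral_X_tup(2)[of A i k w] othersD[of A n i k] that w(2) by (simp add: T_def)
  have vA: "(\<integral>\<omega>. \<bar>w (X i \<omega>, tup A \<omega>)\<bar> \<partial>M) = v" if "A \<in> T" for A
    using integral_X_tup(1)[of A i k "\<lambda>z. \<bar>w z\<bar>"] othersD[of A n i k] that by (simp add: T_def v_def)
  have il: "integrable M (loc_avg k w n i)"
    unfolding loc_avg_def[abs_def] T_def[symmetric]
    by (intro integrable_divide Bochner_Integration.integrable_sum iA)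
  note ip = integral_proj1[OF w, of i]
  show "integrable M (\<lambda>\<omega>. \<bar>loc_avg k w n i \<omega> - proj1 k w (X i \<omega>)\<bar>)"
    using il ip(1) by simp
  have "(\<integral>\<omega>. \<bar>loc_avg k w n i \<omega> - proj1 k w (X i \<omega>)\<bar> \<partial>M)
      \<le> (\<integral>\<omega>. (\<Sum>A\<in>T. \<bar>w (X i \<omega>, tup A \<omega>)\<bar>) / N + \<bar>proj1 k w (X i \<omega>)\<bar> \<partial>M)"
  proof (rule integral_mono)
    show "integrable M (\<lambda>\<omega>. (\<Sum>A\<in>T. \<bar>w (X i \<omega>, tup A \<omega>)\<bar>) / N + \<bar>proj1 k w (X i \<omega>)\<bar>)"
      using iA ip(1)
      by (intro Bochner_Integration.integrable_add integrable_divide Bochner_Integration.integrable_sum) auto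
    fix \<omega>
    have "\<bar>loc_avg k w n i \<omega>\<bar> \<le> (\<Sum>A\<in>T. \<bar>w (X i \<omega>, tup A \<omega>)\<bar>) / N"
      using N0 sum_abs[of "\<lambda>A. w (X i \<omega>, tup A \<omega>)" T]
      unfolding loc_avg_def T_def[symmetric] N_def[symmetric] by (simp add: divide_right_mono)
    then show "\<bar>loc_avg k w n i \<omega> - proj1 k w (X i \<omega>)\<bar>
        \<le> (\<Sum>A\<in>T. \<bar>w (X i \<omega>, tup A \<omega>)\<bar>) / N + \<bar>proj1 k w (X i \<omega>)\<bar>" by linarith
  qed (use il ip(1) in simp)
  also have "\<dots> = (\<Sum>A\<in>T. (\<integral>\<omega>. \<bar>w (X i \<omega>, tup A \<omega>)\<bar> \<partial>M)) / N + (\<integral>\<omega>. \<bar>proj1 k w (X i \<omega>)\<bar> \<partial>M)"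
    using iA ip(1) by (simp add: Bochner_Integration.integral_add Bochner_Integration.integral_sum)
  also have "\<dots> \<le> v + v"
    using N0 vA ip(3) by (simp add: cT v_def)
  finally show "(\<integral>\<omega>. \<bar>loc_avg k w n i \<omega> - proj1 k w (X i \<omega>)\<bar> \<partial>M) \<le> 2 * v" by simp
qed

end

section \<open>Truncation and the total size of the residuals\<close>

context iid_sample
begin

text \<open>Markov's inequality for each truncated piece. The exponents are -2/3 = 1/3 - 1 from the
  variance of the bounded part, and -1/6 = 1 - 2/3 - 1/2 from \<open>n\<close> tail residuals
  measured against the square root of \<open>n\<close>.\<close>

lemma loc_avg_deviation_bound:
  fixes g :: "real \<times> (nat \<Rightarrow> real) \<Rightarrow> real"
  assumes g [measurable]: "g \<in> borel_measurable (borel \<Otimes>\<^sub>M Rpow k)"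
    and int: "integrable (F \<Otimes>\<^sub>M Fpow k) g"
    and int53: "integrable (F \<Otimes>\<^sub>M Fpow k) (\<lambda>z. \<bar>g z\<bar> powr (5/3))"
    and n: "k < n" "1 < n" and \<epsilon>: "\<epsilon> > 0"
  defines "C \<equiv> (\<integral>z. \<bar>g z\<bar> powr (5/3) \<partial>(F \<Otimes>\<^sub>M Fpow k))"
  shows "measure M {\<omega> \<in> space M. (\<Sum>i<n. (loc_avg k g n i \<omega> - proj1 k g (X i \<omega>))\<^sup>2) / real n > \<epsilon>}
    \<le> 8 * real (k\<^sup>2) * C / \<epsilon> * real n powr (-2/3) + 4 * C / sqrt \<epsilon> * real n powr (-1/6)"
proof -
  interpret G: prob_space "Fpow k" by (rule prob_space_Fpow)
  interpret F: prob_space F by (rule prob_space_F)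
  interpret FG: pair_prob_space F "Fpow k" ..
  define u where "u z = (if \<bar>g z\<bar> \<le> real n then g z else 0)" for z
  define w where "w z = (if \<bar>g z\<bar> \<le> real n then 0 else g z)" for z
  have um [measurable]: "u \<in> borel_measurable (borel \<Otimes>\<^sub>M Rpow k)" unfolding u_def by measurable
  have wm [measurable]: "w \<in> borel_measurable (borel \<Otimes>\<^sub>M Rpow k)" unfolding w_def by measurable
  note [measurable] = measurable_proj1[OF g] measurable_proj1[OF um] measurable_proj1[OF wm]
    measurable_loc_avg[OF g] measurable_loc_avg[OF um] measurable_loc_avg[OF wm]
  have ub: "\<bar>u z\<bar> \<le> real n" for z by (simp add: u_def)
  have iu: "integrable (F \<Otimes>\<^sub>M Fpow k) u"
    using ub by (intro FG.P.integrable_const_bound[of _ "real n"]) auto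
  have iw: "integrable (F \<Otimes>\<^sub>M Fpow k) w"
    by (rule Bochner_Integration.integrable_bound[OF int]) (auto simp: w_def)
  have gsum: "g z = u z + w z" for z by (simp add: u_def w_def)
  have C0: "C \<ge> 0" unfolding C_def by simp
  have n0: "real n > 0" using n by simp
  have u2: "(\<integral>z. (u z)\<^sup>2 \<partial>(F \<Otimes>\<^sub>M Fpow k)) \<le> real n powr (1/3) * C"
  proof -
    have "(u z)\<^sup>2 \<le> real n powr (1/3) * \<bar>g z\<bar> powr (5/3)" for z
    proof (cases "\<bar>g z\<bar> \<le> real n \<and> g z \<noteq> 0")
      case True
      \<comment> \<open>The exponent 2 is split as 1/3 + 5/3: truncation bounds the first factor,
        the moment assumption the second. The tail uses 1 = -2/3 + 5/3 in the same way.\<close>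
      have "(u z)\<^sup>2 = \<bar>g z\<bar> powr (1/3 + 5/3)" using True by (simp add: u_def)
      also have "\<dots> = \<bar>g z\<bar> powr (1/3) * \<bar>g z\<bar> powr (5/3)" by (rule powr_add)
      also have "\<dots> \<le> real n powr (1/3) * \<bar>g z\<bar> powr (5/3)"
        using True by (intro mult_right_mono powr_mono2) auto
      finally show ?thesis .
    qed (auto simp: u_def)
    then have "(\<integral>z. (u z)\<^sup>2 \<partial>(F \<Otimes>\<^sub>M Fpow k)) \<le> (\<integral>z. real n powr (1/3) * \<bar>g z\<bar> powr (5/3) \<partial>(F \<Otimes>\<^sub>M Fpow k))"
      using int53 by (intro integral_mono') auto
    then show ?thesis by (simp add: C_def)
  qed
  have w1: "(\<integral>z. \<bar>w z\<bar> \<partial>(F \<Otimes>\<^sub>M Fpow k)) \<le> real n powr (-2/3) * C"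
  proof -
    have "\<bar>w z\<bar> \<le> real n powr (-2/3) * \<bar>g z\<bar> powr (5/3)" for z
    proof (cases "\<bar>g z\<bar> \<le> real n")
      case False
      then have "\<bar>w z\<bar> = \<bar>g z\<bar> powr (-2/3 + 5/3)" by (simp add: w_def)
      also have "\<dots> = \<bar>g z\<bar> powr (-2/3) * \<bar>g z\<bar> powr (5/3)" by (rule powr_add)
      also have "\<dots> \<le> real n powr (-2/3) * \<bar>g z\<bar> powr (5/3)"
        using False n0 by (intro mult_right_mono powr_mono2') auto
      finally show ?thesis .
    qed (auto simp: w_def)
    then have "(\<integral>z. \<bar>w z\<bar> \<partial>(F \<Otimes>\<^sub>M Fpow k)) \<le> (\<integral>z. real n powr (-2/3) * \<bar>g z\<bar> powr (5/3) \<partial>(F \<Otimes>\<^sub>M Fpow k))"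
      using int53 by (intro integral_mono') auto
    then show ?thesis by (simp add: C_def)
  qed
  define a where "a i \<omega> = loc_avg k u n i \<omega> - proj1 k u (X i \<omega>)" for i \<omega>
  define b where "b i \<omega> = loc_avg k w n i \<omega> - proj1 k w (X i \<omega>)" for i \<omega>
  have am [measurable]: "a i \<in> borel_measurable M" for i unfolding a_def by measurable
  have bm [measurable]: "b i \<in> borel_measurable M" for i unfolding b_def by measurable
  have a2: "integrable M (\<lambda>\<omega>. (a i \<omega>)\<^sup>2)" "(\<integral>\<omega>. (a i \<omega>)\<^sup>2 \<partial>M) \<le> real (k\<^sup>2) / real (n - 1) * (real n powr (1/3) * C)"
    if "i < n" for i
  proof -
    note * = loc_avg_variance[OF um ub that n(2,1)]
    show "integrable M (\<lambda>\<omega>. (a i \<omega>)\<^sup>2)" using *(1) by (simp add: a_def)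
    have "real (k\<^sup>2) / real (n - 1) * (\<integral>z. (u z)\<^sup>2 \<partial>(F \<Otimes>\<^sub>M Fpow k))
      \<le> real (k\<^sup>2) / real (n - 1) * (real n powr (1/3) * C)"
      by (intro mult_left_mono u2) auto
    with *(2) show "(\<integral>\<omega>. (a i \<omega>)\<^sup>2 \<partial>M) \<le> real (k\<^sup>2) / real (n - 1) * (real n powr (1/3) * C)"
      unfolding a_def by (rule order_trans)
  qed
  have b1: "integrable M (\<lambda>\<omega>. \<bar>b i \<omega>\<bar>)" "(\<integral>\<omega>. \<bar>b i \<omega>\<bar> \<partial>M) \<le> 2 * (real n powr (-2/3) * C)"
    if "i < n" for i
    using loc_avg_abs_moment[OF wm iw that n(1)] w1 unfolding b_def by linarith+
  \<comment> \<open>The averages add everywhere, but the projections add only where both sections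
    are integrable.\<close>
  have split: "AE \<omega> in M. loc_avg k g n i \<omega> - proj1 k g (X i \<omega>) = a i \<omega> + b i \<omega>" for i
  proof -
    have "AE x in F. integrable (Fpow k) (\<lambda>y. w (x, y))" using FG.AE_integrable_fst'[OF iw] .
    moreover have "AE x in F. integrable (Fpow k) (\<lambda>y. u (x, y))" using FG.AE_integrable_fst'[OF iu] .
    ultimately have "AE x in F. proj1 k g x = proj1 k u x + proj1 k w x"
      by eventually_elim (simp add: proj1_def gsum)
    then have "AE x in distr M borel (X i). proj1 k g x = proj1 k u x + proj1 k w x"
      unfolding distr_X .
    then have "AE \<omega> in M. proj1 k g (X i \<omega>) = proj1 k u (X i \<omega>) + proj1 k w (X i \<omega>)"
      by (subst (asm) AE_distr_iff) auto
    then show ?thesis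
      by eventually_elim
        (simp add: a_def b_def loc_avg_def gsum sum.distrib add_divide_distrib)
  qed
  have split_all: "AE \<omega> in M. \<forall>i\<in>{..<n}. loc_avg k g n i \<omega> - proj1 k g (X i \<omega>) = a i \<omega> + b i \<omega>"
    by (intro AE_finite_allI split) auto
  \<comment> \<open>Both thresholds correspond to a sum of squares of \<epsilon> n / 4, since the
    square of a sum costs a factor 2 on each part. For \<open>b\<close> the condition is put on the
    sum of absolute values, the only quantity whose mean is controlled.\<close>
  define E1 where "E1 = {\<omega> \<in> space M. (\<Sum>i<n. (a i \<omega>)\<^sup>2) > \<epsilon> * real n / 4}"
  define E2 where "E2 = {\<omega> \<in> space M. (\<Sum>i<n. \<bar>b i \<omega>\<bar>) > sqrt (\<epsilon> * real n) / 2}"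
  have Em: "E1 \<in> sets M" "E2 \<in> sets M" unfolding E1_def E2_def by measurable
  have "measure M {\<omega> \<in> space M. (\<Sum>i<n. (loc_avg k g n i \<omega> - proj1 k g (X i \<omega>))\<^sup>2) / real n > \<epsilon>}
      \<le> measure M (E1 \<union> E2)"
  proof (rule finite_measure_mono_AE)
    show "E1 \<union> E2 \<in> sets M" using Em by simp
    show "AE \<omega> in M. \<omega> \<in> {\<omega> \<in> space M. (\<Sum>i<n. (loc_avg k g n i \<omega> - proj1 k g (X i \<omega>))\<^sup>2) / real n > \<epsilon>}
        \<longrightarrow> \<omega> \<in> E1 \<union> E2"
      using split_all
    proof eventually_elim
      case (elim \<omega>)
      show ?case
      proof (rule impI, rule ccontr)
        assume \<omega>: "\<omega> \<in> {\<omega> \<in> space M. (\<Sum>i<n. (loc_avg k g n i \<omega> - proj1 k g (X i \<omega>))\<^sup>2) / real n > \<epsilon>}"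
          and "\<omega> \<notin> E1 \<union> E2"
        then have A: "(\<Sum>i<n. (a i \<omega>)\<^sup>2) \<le> \<epsilon> * real n / 4"
          and B: "(\<Sum>i<n. \<bar>b i \<omega>\<bar>) \<le> sqrt (\<epsilon> * real n) / 2"
          by (auto simp: E1_def E2_def)
        have "(\<Sum>i<n. (b i \<omega>)\<^sup>2) = (sqrt (\<Sum>i<n. (b i \<omega>)\<^sup>2))\<^sup>2"
          by (simp add: sum_nonneg)
        also have "\<dots> \<le> (sqrt (\<epsilon> * real n) / 2)\<^sup>2"
          using L2_set_le_sum_abs[of "\<lambda>i. b i \<omega>" "{..<n}"] B
          by (intro power_mono) (auto simp: L2_set_def sum_nonneg)
        also have "\<dots> = \<epsilon> * real n / 4" using \<epsilon> by (simp add: power_divide)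
        finally have B2: "(\<Sum>i<n. (b i \<omega>)\<^sup>2) \<le> \<epsilon> * real n / 4" .
        have "(\<Sum>i<n. (loc_avg k g n i \<omega> - proj1 k g (X i \<omega>))\<^sup>2) = (\<Sum>i<n. (a i \<omega> + b i \<omega>)\<^sup>2)"
          using elim by (intro sum.cong) auto
        also have "\<dots> \<le> (\<Sum>i<n. 2 * (a i \<omega>)\<^sup>2 + 2 * (b i \<omega>)\<^sup>2)"
        proof (rule sum_mono)
          show "(a i \<omega> + b i \<omega>)\<^sup>2 \<le> 2 * (a i \<omega>)\<^sup>2 + 2 * (b i \<omega>)\<^sup>2" for i
            using sum_squares_bound[of "a i \<omega>" "b i \<omega>"] by (simp add: power2_sum)
        qed
        also have "\<dots> = 2 * (\<Sum>i<n. (a i \<omega>)\<^sup>2) + 2 * (\<Sum>i<n. (b i \<omega>)\<^sup>2)"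
          by (simp add: sum.distrib sum_distrib_left)
        also have "\<dots> \<le> \<epsilon> * real n" using A B2 by linarith
        finally show False using \<omega> n0 by (simp add: divide_simps)
      qed
    qed
  qed
  also have "\<dots> \<le> measure M E1 + measure M E2"
    by (rule measure_Un_le) (rule Em)+
  also have "measure M E1 \<le> 8 * real (k\<^sup>2) * C / \<epsilon> * real n powr (-2/3)"
  proof -
    have "measure M E1 \<le> (\<integral>\<omega>. (\<Sum>i<n. (a i \<omega>)\<^sup>2) \<partial>M) / (\<epsilon> * real n / 4)"
      unfolding E1_def using a2(1) \<epsilon> n0
      by (intro markov_strict Bochner_Integration.integrable_sum sum_nonneg) auto
    also have "(\<integral>\<omega>. (\<Sum>i<n. (a i \<omega>)\<^sup>2) \<partial>M) = (\<Sum>i<n. (\<integral>\<omega>. (a i \<omega>)\<^sup>2 \<partial>M))"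
      using a2(1) by (intro Bochner_Integration.integral_sum) auto
    also have "(\<Sum>i<n. (\<integral>\<omega>. (a i \<omega>)\<^sup>2 \<partial>M)) / (\<epsilon> * real n / 4)
        \<le> (\<Sum>i<n. real (k\<^sup>2) / real (n - 1) * (real n powr (1/3) * C)) / (\<epsilon> * real n / 4)"
      using a2(2) \<epsilon> by (intro divide_right_mono sum_mono) auto
    also have "\<dots> = 4 * real (k\<^sup>2) * C / \<epsilon> * real n powr (1/3) * (1 / real (n - 1))"
    proof -
      have "real n * (K / d * (p * C)) / (\<epsilon> * real n / 4) = 4 * K * C / \<epsilon> * p * (1 / d)" for K d p :: real
        using n0 \<epsilon> by (cases "d = 0") (simp_all add: divide_simps)
      then show ?thesis by (simp only: sum_constant card_lessThan)
    qed
    \<comment> \<open>1 / (n - 1) is at most 2 / n because n is at least 2.\<close>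
    also have "\<dots> \<le> 4 * real (k\<^sup>2) * C / \<epsilon> * real n powr (1/3) * (2 / real n)"
      using n \<epsilon> C0 by (intro mult_left_mono) (auto simp: field_simps)
    also have "\<dots> = 8 * real (k\<^sup>2) * C / \<epsilon> * (real n powr (1/3) * real n powr (-1))"
      using n0 by (simp add: powr_minus_divide)
    also have "real n powr (1/3) * real n powr (-1) = real n powr (-2/3)"
      unfolding powr_add[symmetric] by simp
    finally show ?thesis .
  qed
  also have "measure M E2 \<le> 4 * C / sqrt \<epsilon> * real n powr (-1/6)"
  proof -
    have "measure M E2 \<le> (\<integral>\<omega>. (\<Sum>i<n. \<bar>b i \<omega>\<bar>) \<partial>M) / (sqrt (\<epsilon> * real n) / 2)"
      unfolding E2_def using b1(1) \<epsilon> n0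
      by (intro markov_strict Bochner_Integration.integrable_sum sum_nonneg) auto
    also have "(\<integral>\<omega>. (\<Sum>i<n. \<bar>b i \<omega>\<bar>) \<partial>M) = (\<Sum>i<n. (\<integral>\<omega>. \<bar>b i \<omega>\<bar> \<partial>M))"
      using b1(1) by (intro Bochner_Integration.integral_sum) auto
    also have "(\<Sum>i<n. (\<integral>\<omega>. \<bar>b i \<omega>\<bar> \<partial>M)) / (sqrt (\<epsilon> * real n) / 2)
        \<le> (\<Sum>i<n. 2 * (real n powr (-2/3) * C)) / (sqrt (\<epsilon> * real n) / 2)"
      using b1(2) \<epsilon> by (intro divide_right_mono sum_mono) auto
    also have "\<dots> = 4 * C / sqrt \<epsilon> * (real n powr 1 * real n powr (-2/3) * real n powr (-1/2))"
      using n0 \<epsilon> by (simp add: real_sqrt_mult powr_minus_divide powr_half_sqrt mult_ac)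
    also have "real n powr 1 * real n powr (-2/3) * real n powr (-1/2) = real n powr (-1/6)"
      unfolding powr_add[symmetric] by simp
    finally show ?thesis .
  qed
  finally show ?thesis by simp
qed

lemma loc_avg_deviation_oP:
  fixes g :: "real \<times> (nat \<Rightarrow> real) \<Rightarrow> real"
  assumes g [measurable]: "g \<in> borel_measurable (borel \<Otimes>\<^sub>M Rpow k)"
    and int: "integrable (F \<Otimes>\<^sub>M Fpow k) g"
    and int53: "integrable (F \<Otimes>\<^sub>M Fpow k) (\<lambda>z. \<bar>g z\<bar> powr (5/3))"
  shows "oP_1 M (\<lambda>n \<omega>. (\<Sum>i<n. (loc_avg k g n i \<omega> - proj1 k g (X i \<omega>))\<^sup>2) / real n)"
  unfolding oP_1_def
proof (intro allI impI)
  fix \<epsilon> :: real assume \<epsilon>: "\<epsilon> > 0"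
  define C where "C = (\<integral>z. \<bar>g z\<bar> powr (5/3) \<partial>(F \<Otimes>\<^sub>M Fpow k))"
  define r where "r n = 8 * real (k\<^sup>2) * C / \<epsilon> * real n powr (-2/3) + 4 * C / sqrt \<epsilon> * real n powr (-1/6)" for n
  have p: "(\<lambda>n. real n powr s) \<longlonglongrightarrow> 0" if "s < 0" for s
    using tendsto_neg_powr[OF that filterlim_real_sequentially] .
  have "r \<longlonglongrightarrow> 8 * real (k\<^sup>2) * C / \<epsilon> * 0 + 4 * C / sqrt \<epsilon> * 0"
    unfolding r_def by (intro tendsto_add tendsto_mult tendsto_const p) auto
  then have r0: "r \<longlonglongrightarrow> 0" by simp
  show "(\<lambda>n. measure M {\<omega> \<in> space M. \<bar>(\<Sum>i<n. (loc_avg k g n i \<omega> - proj1 k g (X i \<omega>))\<^sup>2) / real n\<bar> > \<epsilon>}) \<longlonglongrightarrow> 0"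
  proof (rule tendsto_sandwich[OF _ _ tendsto_const r0])
    show "\<forall>\<^sub>F n in sequentially. measure M {\<omega> \<in> space M. \<bar>(\<Sum>i<n. (loc_avg k g n i \<omega> - proj1 k g (X i \<omega>))\<^sup>2) / real n\<bar> > \<epsilon>} \<le> r n"
      using eventually_gt_at_top[of k] eventually_gt_at_top[of 1]
    proof eventually_elim
      case (elim n)
      have nn: "\<bar>(\<Sum>i<n. (loc_avg k g n i \<omega> - proj1 k g (X i \<omega>))\<^sup>2) / real n\<bar>
        = (\<Sum>i<n. (loc_avg k g n i \<omega> - proj1 k g (X i \<omega>))\<^sup>2) / real n" for \<omega>
        by (simp add: sum_nonneg)
      show ?case
        unfolding nn r_def C_def by (rule loc_avg_deviation_bound[OF g int int53 elim \<epsilon>])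
    qed
  qed auto
qed

end

section \<open>Sums of squares under a normal limit\<close>

text \<open>The expansion to order four gives 1 - cos x at least x^2/2 - x^4/24, hence at least
  (11/24) x^2 on the unit interval; 3 is a round constant above 24/11.\<close>

lemma square_le_one_minus_cos:
  fixes x :: real
  assumes "\<bar>x\<bar> \<le> 1"
  shows "x\<^sup>2 \<le> 3 * (1 - cos x)"
proof -
  obtain t where t: "cos x = (\<Sum>m<4. cos_coeff m * x ^ m) + (cos (t + 1/2 * real 4 * pi) / fact 4) * x ^ 4"
    using Maclaurin_cos_expansion[of x 4] by blast
  have "(\<Sum>m<4. cos_coeff m * x ^ m)
      = cos_coeff 0 + cos_coeff 1 * x + cos_coeff 2 * x\<^sup>2 + cos_coeff 3 * x ^ 3"
    by (simp add: eval_nat_numeral)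
  also have "\<dots> = 1 - x\<^sup>2 / 2" by (simp add: cos_coeff_def)
  finally have "(\<Sum>m<4. cos_coeff m * x ^ m) = 1 - x\<^sup>2 / 2" .
  moreover define R where "R = (cos (t + 1/2 * real 4 * pi) / fact 4) * x ^ 4"
  ultimately have cosx: "cos x = 1 - x\<^sup>2 / 2 + R" using t by (simp only:)
  have "R \<le> 1 / 24 * x ^ 4"
    unfolding R_def by (intro mult_right_mono) (auto simp: fact_numeral divide_right_mono)
  moreover have "x ^ 4 \<le> x\<^sup>2"
    using assms power_decreasing[of 2 4 "\<bar>x\<bar>"] by simp
  moreover have "s \<le> 3 * (1 - c)" if "c = 1 - s / 2 + R" "R \<le> 1 / 24 * q" "q \<le> s" "0 \<le> s" for s c q :: real
    using that by (simp add: field_simps)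
  ultimately show ?thesis using cosx zero_le_power2[of x] by blast
qed

text \<open>Half-angle formula. The bound is linear rather than quadratic so that integrating it
  needs only a first moment.\<close>

lemma one_minus_cos_le_abs: "1 - cos x \<le> \<bar>x\<bar>" for x :: real
proof -
  have "1 - cos x = 2 * (sin (x / 2))\<^sup>2"
    using cos_double_sin[of "x / 2"] by simp
  also have "\<dots> \<le> 2 * \<bar>sin (x / 2)\<bar>"
    using abs_sin_le_one[of "x / 2"] mult_left_le[of "\<bar>sin (x / 2)\<bar>" "\<bar>sin (x / 2)\<bar>"]
    by (simp add: power2_eq_square)
  also have "\<dots> \<le> \<bar>x\<bar>" using abs_sin_x_le_abs_x[of "x / 2"] by simp
  finally show ?thesis .
qed

section \<open>Characteristic functions near zero and truncated moments\<close>

lemma (in real_distribution) integrable_trig: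
  "integrable M (\<lambda>x. cos (t * x))" "integrable M (\<lambda>x. sin (t * x))"
  by (rule integrable_const_bound[of _ 1]; simp)+

lemma (in real_distribution) Re_char: "Re (char M t) = (\<integral>x. cos (t * x) \<partial>M)"
  and Im_char: "Im (char M t) = (\<integral>x. sin (t * x) \<partial>M)"
proof -
  have i: "integrable M (\<lambda>x. iexp (t * x))" by (intro integrable_iexp) auto
  have "iexp (t * x) = Complex (cos (t * x)) (sin (t * x))" for x
    by (simp add: cis_conv_exp[symmetric] complex_eq_iff flip: of_real_mult)
  then show "Re (char M t) = (\<integral>x. cos (t * x) \<partial>M)" "Im (char M t) = (\<integral>x. sin (t * x) \<partial>M)"
    unfolding char_def integral_Re[OF i, symmetric] integral_Im[OF i, symmetric] by simp_all
qed

text \<open>First-order bounds only, because a variable in the domain of attraction may have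
  infinite variance.\<close>

lemma (in real_distribution) char_near_zero:
  assumes int: "integrable M (\<lambda>x. x)"
  shows "1 - Re (char M t) \<le> \<bar>t\<bar> * (\<integral>x. \<bar>x\<bar> \<partial>M)" and "\<bar>Im (char M t)\<bar> \<le> \<bar>t\<bar> * (\<integral>x. \<bar>x\<bar> \<partial>M)"
proof -
  have "1 - Re (char M t) = (\<integral>x. 1 - cos (t * x) \<partial>M)"
    using integrable_trig by (simp add: Re_char prob_space[unfolded space_eq_univ])
  also have "\<dots> \<le> (\<integral>x. \<bar>t\<bar> * \<bar>x\<bar> \<partial>M)"
    using int integrable_trig one_minus_cos_le_abs[of "t * x" for x, unfolded abs_mult]
    by (intro integral_mono) auto
  finally show "1 - Re (char M t) \<le> \<bar>t\<bar> * (\<integral>x. \<bar>x\<bar> \<partial>M)" by simp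
  have "\<bar>Im (char M t)\<bar> \<le> (\<integral>x. \<bar>sin (t * x)\<bar> \<partial>M)" unfolding Im_char by (rule integral_abs_bound)
  also have "\<dots> \<le> (\<integral>x. \<bar>t\<bar> * \<bar>x\<bar> \<partial>M)"
    using int integrable_trig abs_sin_x_le_abs_x[of "t * x" for x, unfolded abs_mult]
    by (intro integral_mono) auto
  finally show "\<bar>Im (char M t)\<bar> \<le> \<bar>t\<bar> * (\<integral>x. \<bar>x\<bar> \<partial>M)" by simp
qed

text \<open>The quadratic bound on the cosine, rescaled by \<open>B\<close> and integrated. Outside
  the truncation range the integrand on the right is still nonnegative.\<close>

lemma (in real_distribution) truncated_second_moment_le_char:
  assumes "B > 0"
  shows "(\<integral>x. (if \<bar>x\<bar> \<le> B then x\<^sup>2 else 0) \<partial>M) \<le> 3 * B\<^sup>2 * (1 - Re (char M (1 / B)))"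
proof -
  have "(\<integral>x. (if \<bar>x\<bar> \<le> B then x\<^sup>2 else 0) \<partial>M) \<le> (\<integral>x. 3 * B\<^sup>2 * (1 - cos (1 / B * x)) \<partial>M)"
  proof (rule integral_mono)
    have "norm (if \<bar>x\<bar> \<le> B then x\<^sup>2 else 0) \<le> B\<^sup>2" for x :: real
      using power_mono[of "\<bar>x\<bar>" B 2] by simp
    then show "integrable M (\<lambda>x. if \<bar>x\<bar> \<le> B then x\<^sup>2 else 0)"
      by (intro integrable_const_bound[of _ "B\<^sup>2"] AE_I2) auto
    show "integrable M (\<lambda>x. 3 * B\<^sup>2 * (1 - cos (1 / B * x)))"
      by (intro integrable_mult_right Bochner_Integration.integrable_diff integrable_trig) simp
    fix x
    show "(if \<bar>x\<bar> \<le> B then x\<^sup>2 else 0) \<le> 3 * B\<^sup>2 * (1 - cos (1 / B * x))"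
    proof (cases "\<bar>x\<bar> \<le> B")
      case True
      have "\<bar>1 / B * x\<bar> \<le> 1" using True assms by simp
      then have "(1 / B * x)\<^sup>2 \<le> 3 * (1 - cos (1 / B * x))"
        by (rule square_le_one_minus_cos)
      then have "B\<^sup>2 * (1 / B * x)\<^sup>2 \<le> B\<^sup>2 * (3 * (1 - cos (1 / B * x)))"
        by (rule mult_left_mono) simp
      moreover have "B\<^sup>2 * (1 / B * x)\<^sup>2 = x\<^sup>2"
        unfolding power_mult_distrib[symmetric] using assms by simp
      ultimately show ?thesis using True by (simp only: if_True mult.assoc mult.left_commute)
    qed simp
  qed
  also have "\<dots> = 3 * B\<^sup>2 * (\<integral>x. 1 - cos (1 / B * x) \<partial>M)"
    by (rule integral_mult_right_zero)
  also have "(\<integral>x. 1 - cos (1 / B * x) \<partial>M) = 1 - Re (char M (1 / B))"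
    unfolding Re_char using integrable_trig(1)[of "1 / B"]
    by (subst Bochner_Integration.integral_diff) (simp_all add: prob_space[unfolded space_eq_univ])
  finally show ?thesis .
qed

text \<open>Independence turns the sum into a power, and taking moduli removes the phase produced by
  the centring.\<close>

lemma (in iid_sample) cmod_char_sum:
  "cmod (char (distr M borel (\<lambda>\<omega>. ((\<Sum>i<n. X i \<omega>) - real n * \<mu>) / B)) t) = cmod (char F (t / B)) ^ n"
proof -
  have eq: "((\<Sum>i<n. X i \<omega>) - real n * \<mu>) / B = (\<Sum>i<n. (X i \<omega> - \<mu>) / B)" for \<omega>
    by (simp add: sum_subtractf sum_divide_distrib[symmetric])
  have "indep_vars (\<lambda>_. borel) (\<lambda>i \<omega>. (X i \<omega> - \<mu>) / B) UNIV"
    by (rule indep_vars_compose2[OF indep, where Y = "\<lambda>_ x. (x - \<mu>) / B"]) simp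
  then have "indep_vars (\<lambda>_. borel) (\<lambda>i \<omega>. (X i \<omega> - \<mu>) / B) {..<n}"
    by (rule indep_vars_subset) simp
  then have "char (distr M borel (\<lambda>\<omega>. \<Sum>i<n. (X i \<omega> - \<mu>) / B)) t
    = (\<Prod>i<n. char (distr M borel (\<lambda>\<omega>. (X i \<omega> - \<mu>) / B)) t)"
    by (rule char_distr_sum)
  moreover have "cmod (char (distr M borel (\<lambda>\<omega>. (X i \<omega> - \<mu>) / B)) t) = cmod (char F (t / B))" for i
  proof -
    have "char (distr M borel (\<lambda>\<omega>. (X i \<omega> - \<mu>) / B)) t = (\<integral>\<omega>. iexp (t * ((X i \<omega> - \<mu>) / B)) \<partial>M)"
      unfolding char_def by (subst integral_distr) auto
    also have "\<dots> = (\<integral>\<omega>. iexp (- t * \<mu> / B) * iexp (t / B * X i \<omega>) \<partial>M)"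
    proof (intro Bochner_Integration.integral_cong refl)
      fix \<omega>
      have "t * ((X i \<omega> - \<mu>) / B) = - t * \<mu> / B + t / B * X i \<omega>"
        by (simp add: diff_divide_distrib right_diff_distrib)
      then show "iexp (t * ((X i \<omega> - \<mu>) / B)) = iexp (- t * \<mu> / B) * iexp (t / B * X i \<omega>)"
        by (simp only: of_real_add distrib_left exp_add)
    qed
    also have "\<dots> = iexp (- t * \<mu> / B) * (\<integral>\<omega>. iexp (t / B * X i \<omega>) \<partial>M)"
      by (rule integral_mult_right_zero)
    also have "(\<integral>\<omega>. iexp (t / B * X i \<omega>) \<partial>M) = char F (t / B)"
      unfolding char_def distr_X[of i, symmetric] by (subst integral_distr) auto
    finally show ?thesis by (simp only: norm_mult norm_exp_i_times mult_1)
  qed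
  ultimately show ?thesis unfolding eq by (simp add: prod_norm[symmetric])
qed

text \<open>With finite variance the factor is a constant from index 1 on, and it is positive
  because a slowly varying function is eventually positive; with infinite variance it
  diverges.\<close>

lemma DAN_factor_lower_bound:
  assumes "DAN_factor M Y L"
  obtains c where "c > 0" "\<forall>\<^sub>F n in sequentially. L (real n) \<ge> c"
proof -
  have ev: "\<forall>\<^sub>F n in sequentially. L (real n) > 0"
    using assms by (intro eventually_compose_filterlim[OF _ filterlim_real_sequentially])
      (simp add: DAN_factor_def slowly_varying_def)
  define \<mu> where "\<mu> = (\<integral>\<omega>. Y 0 \<omega> \<partial>M)"
  show thesis
  proof (cases "integrable M (\<lambda>\<omega>. (Y 0 \<omega> - \<mu>)\<^sup>2)")
    case True
    then have c: "L (real n) = sqrt (\<integral>\<omega>. (Y 0 \<omega> - \<mu>)\<^sup>2 \<partial>M)" if "n \<ge> 1" for n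
      using assms that by (simp add: DAN_factor_def Let_def \<mu>_def)
    have "\<forall>\<^sub>F n in sequentially. L (real n) > 0 \<and> n \<ge> (1::nat)"
      using ev eventually_ge_at_top by (rule eventually_conj)
    then obtain n0 where "L (real n0) > 0" "n0 \<ge> (1::nat)"
      using eventually_happens'[OF sequentially_bot] by blast
    then have "sqrt (\<integral>\<omega>. (Y 0 \<omega> - \<mu>)\<^sup>2 \<partial>M) > 0" using c[of n0] by simp
    moreover have "\<forall>\<^sub>F n in sequentially. L (real n) \<ge> sqrt (\<integral>\<omega>. (Y 0 \<omega> - \<mu>)\<^sup>2 \<partial>M)"
      using eventually_ge_at_top[of 1] by eventually_elim (simp add: c)
    ultimately show thesis using that by blast
  next
    case False
    then have "filterlim (\<lambda>n. L (real n)) at_top sequentially"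
      using assms by (simp add: DAN_factor_def Let_def \<mu>_def)
    then have "\<forall>\<^sub>F n in sequentially. L (real n) \<ge> 1" by (simp add: filterlim_at_top)
    then show thesis using that[of 1] by simp
  qed
qed

section \<open>Tail and tightness bounds in the domain of attraction\<close>

context iid_sample
begin

lemma real_distribution_F: "real_distribution F"
  unfolding distr_X[of 0, symmetric] by (rule real_distribution_distr) simp

lemma integrable_F_iff:
  fixes f :: "real \<Rightarrow> real"
  assumes [measurable]: "f \<in> borel_measurable borel"
  shows "integrable F f \<longleftrightarrow> integrable M (\<lambda>\<omega>. f (X i \<omega>))"
  unfolding distr_X[of i, symmetric] by (subst integrable_distr_eq) auto

lemma integral_F:
  fixes f :: "real \<Rightarrow> real"
  assumes [measurable]: "f \<in> borel_measurable borel"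
  shows "(\<integral>\<omega>. f (X i \<omega>) \<partial>M) = integral\<^sup>L F f"
  unfolding distr_X[of i, symmetric] by (subst integral_distr) auto

lemma measure_F:
  assumes [measurable]: "S \<in> sets borel"
  shows "measure M {\<omega> \<in> space M. X i \<omega> \<in> S} = measure F S"
  unfolding distr_X[of i, symmetric]
  by (subst measure_distr) (auto intro!: arg_cong[of _ _ "measure M"])

text \<open>The normal limit controls only the modulus of \<phi>: n (1 - |\<phi>|^2) is bounded
  through the logarithm. The real part is recovered from 1 - Re \<phi> \<le> 1 - (Re \<phi>)^2 = 1 -
  |\<phi>|^2 + (Im \<phi>)^2, where the first moment makes the imaginary part of order 1 /
  \<open>B n\<close>, so that n (Im \<phi>)^2 stays bounded.\<close>

lemma char_defect_bounded:
  assumes int: "integrable M (X 0)"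
    and L: "DAN_factor M X L"
  obtains C where "C > 0"
    and "\<forall>\<^sub>F n in sequentially. real n * (1 - Re (char F (1 / (sqrt (real n) * L (real n))))) \<le> C"
proof -
  interpret F: real_distribution F by (rule real_distribution_F)
  define B where "B n = sqrt (real n) * L (real n)" for n
  define \<phi> where "\<phi> n = char F (1 / B n)" for n
  define E where "E = (\<integral>x. \<bar>x\<bar> \<partial>F)"
  obtain c where c: "c > 0" "\<forall>\<^sub>F n in sequentially. L (real n) \<ge> c"
    using DAN_factor_lower_bound[OF L] .
  have intF: "integrable F (\<lambda>x. x)"
    using int by (subst integrable_F_iff[of _ 0]) simp_all
  have E0: "E \<ge> 0" by (simp add: E_def)
  define \<mu> where "\<mu> = (\<integral>\<omega>. X 0 \<omega> \<partial>M)"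
  have "weak_conv_m (\<lambda>n. distr M borel (\<lambda>\<omega>. ((\<Sum>i<n. X i \<omega>) - real n * \<mu>) / B n)) std_normal_distribution"
    using L by (simp add: DAN_factor_def Let_def \<mu>_def B_def)
  then have "(\<lambda>n. char (distr M borel (\<lambda>\<omega>. ((\<Sum>i<n. X i \<omega>) - real n * \<mu>) / B n)) 1)
      \<longlonglongrightarrow> char std_normal_distribution 1"
    by (intro levy_continuity1 real_distribution_distr real_dist_normal_dist) auto
  from tendsto_norm[OF this] have "(\<lambda>n. cmod (\<phi> n) ^ n) \<longlonglongrightarrow> exp (-1/2)"
    by (simp add: cmod_char_sum \<phi>_def char_std_normal_distribution)
  \<comment> \<open>Any positive number below the limit would do; this one gives n ln |\<phi>| > -1
    and hence the constant 2 below.\<close>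
  moreover have "exp (-1) < exp (-1/2 :: real)" by simp
  ultimately have "\<forall>\<^sub>F n in sequentially. exp (-1) < cmod (\<phi> n) ^ n"
    by (rule order_tendstoD(1))
  \<comment> \<open>From here on \<open>E\<close> is at most \<open>B n\<close>, which makes Re
    \<phi> nonnegative; without its sign the comparison with its square fails.\<close>
  moreover have "\<forall>\<^sub>F n in sequentially. sqrt (real n) \<ge> E / c"
    using filterlim_compose[OF sqrt_at_top filterlim_real_sequentially] by (simp add: filterlim_at_top)
  ultimately have "\<forall>\<^sub>F n in sequentially. real n * (1 - Re (\<phi> n)) \<le> 2 + E\<^sup>2 / c\<^sup>2"
    using c(2) eventually_gt_at_top[of 0]
  proof eventually_elim
    case (elim n)
    have L0: "L (real n) > 0" using elim c by linarith
    have B0: "B n > 0" using L0 elim by (simp add: B_def)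
    have cB: "c * sqrt (real n) \<le> B n" using elim by (simp add: B_def mult.commute)
    define \<rho> where "\<rho> = cmod (\<phi> n)"
    have r0: "\<rho> > 0"
    proof (rule ccontr)
      assume "\<not> \<rho> > 0"
      then have "\<rho> = 0" by (simp add: \<rho>_def)
      with elim have "exp (-1 :: real) < 0" by (simp add: \<rho>_def power_0_left)
      then show False by simp
    qed
    have "-1 < ln (\<rho> ^ n)"
      using elim r0 ln_less_cancel_iff[of "exp (-1)" "\<rho> ^ n"] unfolding \<rho>_def by simp
    then have "real n * ln \<rho> > -1" using r0 by (simp add: ln_realpow)
    moreover have "real n * (1 - \<rho>\<^sup>2) \<le> real n * (- 2 * ln \<rho>)"
    proof (rule mult_left_mono)
      have "ln (\<rho>\<^sup>2) \<le> \<rho>\<^sup>2 - 1" using r0 by (intro ln_le_minus_one) simp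
      then show "1 - \<rho>\<^sup>2 \<le> - 2 * ln \<rho>" using r0 by (simp add: ln_realpow)
    qed simp
    ultimately have nr: "real n * (1 - \<rho>\<^sup>2) \<le> 2" by (simp add: algebra_simps)
    have EB: "1 / B n * E \<le> 1"
    proof -
      have "E \<le> c * sqrt (real n)" using elim c by (simp add: divide_le_eq mult.commute)
      also note cB
      finally show ?thesis using B0 by simp
    qed
    have B_abs: "\<bar>1 / B n\<bar> = 1 / B n" using B0 by simp
    have "1 - Re (\<phi> n) \<le> 1 / B n * E"
      using F.char_near_zero(1)[OF intF, of "1 / B n"] unfolding B_abs \<phi>_def E_def .
    then have "Re (\<phi> n) \<ge> 0" using EB by linarith
    moreover have "Re (\<phi> n) \<le> 1"
      using complex_Re_le_cmod[of "\<phi> n"] F.cmod_char_le_1[of "1 / B n"] unfolding \<phi>_def by simp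
    ultimately have "1 - Re (\<phi> n) \<le> 1 - (Re (\<phi> n))\<^sup>2"
      by (simp add: power2_eq_square mult_left_le)
    also have "\<dots> = 1 - \<rho>\<^sup>2 + (Im (\<phi> n))\<^sup>2" by (simp add: \<rho>_def cmod_power2)
    finally have "real n * (1 - Re (\<phi> n)) \<le> real n * (1 - \<rho>\<^sup>2 + (Im (\<phi> n))\<^sup>2)"
      by (intro mult_left_mono) auto
    then have "real n * (1 - Re (\<phi> n)) \<le> real n * (1 - \<rho>\<^sup>2) + real n * (Im (\<phi> n))\<^sup>2"
      by (simp add: algebra_simps)
    moreover have "real n * (Im (\<phi> n))\<^sup>2 \<le> E\<^sup>2 / c\<^sup>2"
    proof -
      have "\<bar>Im (\<phi> n)\<bar> \<le> E / B n"
        using F.char_near_zero(2)[OF intF, of "1 / B n"] B0 unfolding \<phi>_def E_def by simp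
      also have "\<dots> \<le> E / (c * sqrt (real n))"
        using cB c(1) elim E0 B0 by (intro divide_left_mono mult_pos_pos) auto
      finally have "\<bar>Im (\<phi> n)\<bar>\<^sup>2 \<le> (E / (c * sqrt (real n)))\<^sup>2" by (intro power_mono) auto
      also have "\<dots> = E\<^sup>2 / (c\<^sup>2 * real n)"
        using elim by (simp add: power_divide power_mult_distrib)
      finally have "real n * (Im (\<phi> n))\<^sup>2 \<le> real n * (E\<^sup>2 / (c\<^sup>2 * real n))"
        by (intro mult_left_mono) auto
      then show ?thesis using elim by simp
    qed
    ultimately show ?case using nr by linarith
  qed
  moreover have "2 + E\<^sup>2 / c\<^sup>2 > 0" by (intro add_pos_nonneg) auto
  ultimately show thesis using that unfolding \<phi>_def B_def by blast
qed

text \<open>The tail bound telescopes over the scales \<open>2\<^sup>j n\<close>: passing from one scale to the next costs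
  a truncated second moment, which the characteristic function at the next scale controls.\<close>

lemma DAN_tail_bounds:
  assumes int: "integrable M (X 0)"
    and L: "DAN_factor M X L"
  defines "B \<equiv> \<lambda>n. sqrt (real n) * L (real n)"
  obtains C N where "C > 0" "N \<ge> 1"
    and "\<And>n. n \<ge> N \<Longrightarrow> L (real n) > 0"
    and "\<And>n. n \<ge> N \<Longrightarrow> L (real (2 * n)) \<le> 2 * L (real n)"
    and "\<And>n. n \<ge> N \<Longrightarrow> (\<integral>x. (if \<bar>x\<bar> \<le> B n then x\<^sup>2 else 0) \<partial>F) \<le> C * (L (real n))\<^sup>2"
    and "\<And>n. n \<ge> N \<Longrightarrow> real n * measure F {x. \<bar>x\<bar> > B n} \<le> 8 * C"
proof -
  interpret F: real_distribution F by (rule real_distribution_F)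
  obtain C' where C': "C' > 0"
    "\<forall>\<^sub>F n in sequentially. real n * (1 - Re (char F (1 / B n))) \<le> C'"
    using char_defect_bounded[OF int L] unfolding B_def .
  obtain c where c: "c > 0" "\<forall>\<^sub>F n in sequentially. L (real n) \<ge> c"
    using DAN_factor_lower_bound[OF L] .
  have intF: "integrable F (\<lambda>x. x)"
    using int by (subst integrable_F_iff[of _ 0]) simp_all
  \<comment> \<open>Only doubling of the argument is used, and instead of the limit 1 only the bound
    2 on the ratio.\<close>
  have "((\<lambda>x. L (2 * x) / L x) \<longlongrightarrow> 1) at_top"
    using L by (simp add: DAN_factor_def slowly_varying_def)
  then have "\<forall>\<^sub>F x in at_top. L (2 * x) / L x < 2" by (rule order_tendstoD(2)) simp
  then have ev2: "\<forall>\<^sub>F n in sequentially. L (2 * real n) / L (real n) < 2"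
    by (rule eventually_compose_filterlim[OF _ filterlim_real_sequentially])
  have "\<forall>\<^sub>F n in sequentially. real n * (1 - Re (char F (1 / B n))) \<le> C' \<and> L (real n) \<ge> c
      \<and> L (2 * real n) / L (real n) < 2 \<and> n \<ge> 1"
    using C'(2) c(2) ev2 eventually_ge_at_top[of 1] by eventually_elim auto
  then obtain N where N: "\<And>n. n \<ge> N \<Longrightarrow> real n * (1 - Re (char F (1 / B n))) \<le> C' \<and> L (real n) \<ge> c
      \<and> L (2 * real n) / L (real n) < 2 \<and> n \<ge> 1"
    unfolding eventually_sequentially by blast
  define C where "C = 3 * C'"
  have Lpos: "L (real n) > 0" if "n \<ge> N" for n using N[OF that] c by linarith
  have Bpos: "B n > 0" if "n \<ge> N" for n using Lpos[OF that] N[OF that] by (simp add: B_def)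
  have L2: "L (real (2 * n)) \<le> 2 * L (real n)" if "n \<ge> N" for n
    using N[OF that] Lpos[OF that] by (simp add: divide_less_eq)
  define G where "G n = (\<integral>x. (if \<bar>x\<bar> \<le> B n then x\<^sup>2 else 0) \<partial>F)" for n
  have G: "G n \<le> C * (L (real n))\<^sup>2" if "n \<ge> N" for n
  proof -
    have "G n \<le> 3 * (B n)\<^sup>2 * (1 - Re (char F (1 / B n)))"
      unfolding G_def by (rule F.truncated_second_moment_le_char[OF Bpos[OF that]])
    also have "\<dots> = 3 * (L (real n))\<^sup>2 * (real n * (1 - Re (char F (1 / B n))))"
      by (simp add: B_def power_mult_distrib)
    also have "\<dots> \<le> 3 * (L (real n))\<^sup>2 * C'" using N[OF that] by (intro mult_left_mono) auto
    finally show ?thesis by (simp add: C_def mult_ac)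
  qed
  define p where "p n = measure F {x. \<bar>x\<bar> > B n}" for n
  \<comment> \<open>A point beyond \<open>B n\<close> lies beyond \<open>B (2 * n)\<close> or adds
    at least the square of \<open>B n\<close> to the second moment truncated at
    \<open>B (2 * n)\<close>. Markov's inequality and the doubling bound leave C (2 L)^2 / (n L^2) =
    4 C / n.\<close>
  have step: "p n \<le> p (2 * n) + 4 * C / real n" if "n \<ge> N" for n
  proof -
    have n2: "2 * n \<ge> N" using that by simp
    define f where "f x = (if \<bar>x\<bar> \<le> B (2 * n) then x\<^sup>2 else 0)" for x :: real
    have [measurable]: "f \<in> borel_measurable borel" unfolding f_def by measurable
    have "norm (f x) \<le> (B (2 * n))\<^sup>2" for x :: real
      using power_mono[of "\<bar>x\<bar>" "B (2 * n)" 2] by (simp add: f_def)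
    then have fint: "integrable F f"
      by (intro F.integrable_const_bound[of _ "(B (2 * n))\<^sup>2"] AE_I2) auto
    have n0: "real n > 0" using N[OF that] by simp
    have "p n \<le> measure F ({x. \<bar>x\<bar> > B (2 * n)} \<union> {x \<in> space F. f x \<ge> (B n)\<^sup>2})"
      unfolding p_def
    proof (rule F.finite_measure_mono)
      show "{x. \<bar>x\<bar> > B n} \<subseteq> {x. \<bar>x\<bar> > B (2 * n)} \<union> {x \<in> space F. f x \<ge> (B n)\<^sup>2}"
        using Bpos[OF that] power_mono[of "B n" "\<bar>x\<bar>" 2 for x] by (auto simp: f_def)
    qed measurable
    also have "\<dots> \<le> p (2 * n) + measure F {x \<in> space F. f x \<ge> (B n)\<^sup>2}"
      unfolding p_def by (intro measure_Un_le) measurable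
    also have "measure F {x \<in> space F. f x \<ge> (B n)\<^sup>2} \<le> G (2 * n) / (B n)\<^sup>2"
      using integral_Markov_inequality_measure[OF fint, of "space F" "(B n)\<^sup>2"] Bpos[OF that]
      unfolding G_def f_def by auto
    also have "\<dots> \<le> C * (2 * L (real n))\<^sup>2 / (B n)\<^sup>2"
    proof (intro divide_right_mono)
      have "(L (real (2 * n)))\<^sup>2 \<le> (2 * L (real n))\<^sup>2"
        using L2[OF that] Lpos[OF n2] by (intro power_mono) auto
      then have "C * (L (real (2 * n)))\<^sup>2 \<le> C * (2 * L (real n))\<^sup>2"
        using C'(1) by (intro mult_left_mono) (auto simp: C_def)
      with G[OF n2] show "G (2 * n) \<le> C * (2 * L (real n))\<^sup>2" by (rule order_trans)
    qed simp
    also have "\<dots> = 4 * C / real n"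
      using Lpos[OF that] n0 by (simp add: B_def power_mult_distrib)
    finally show ?thesis by simp
  qed
  \<comment> \<open>A crude first-moment bound of order n^(-1/2). It is too weak for the claim but
    closes the telescoping at infinity.\<close>
  have p0: "p \<longlonglongrightarrow> 0"
  proof (rule tendsto_sandwich[OF _ _ tendsto_const])
    show "\<forall>\<^sub>F n in sequentially. p n \<le> (\<integral>x. \<bar>x\<bar> \<partial>F) / c * inverse (sqrt (real n))"
      using eventually_ge_at_top[of N]
    proof eventually_elim
      case (elim n)
      have "p n \<le> (\<integral>x. \<bar>x\<bar> \<partial>F) / B n"
        using F.markov_strict[of "\<lambda>x. \<bar>x\<bar>" "B n"] intF Bpos[OF elim] by (simp add: p_def)
      also have "\<dots> \<le> (\<integral>x. \<bar>x\<bar> \<partial>F) / (sqrt (real n) * c)"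
        using N[OF elim] c Bpos[OF elim] unfolding B_def
        by (intro divide_left_mono mult_left_mono mult_pos_pos) auto
      finally show ?case by (simp add: divide_inverse mult_ac)
    qed
    have "filterlim (\<lambda>n. sqrt (real n)) at_top sequentially"
      by (rule filterlim_compose[OF sqrt_at_top filterlim_real_sequentially])
    then have "(\<lambda>n. (\<integral>x. \<bar>x\<bar> \<partial>F) / c * inverse (sqrt (real n))) \<longlonglongrightarrow> (\<integral>x. \<bar>x\<bar> \<partial>F) / c * 0"
      by (intro tendsto_mult tendsto_const tendsto_inverse_0_at_top)
    then show "(\<lambda>n. (\<integral>x. \<bar>x\<bar> \<partial>F) / c * inverse (sqrt (real n))) \<longlonglongrightarrow> 0" by simp
  qed (simp add: p_def)
  have tail: "real n * p n \<le> 8 * C" if "n \<ge> N" for n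
  proof -
    \<comment> \<open>The corrections 4 C / (2^j n) form a geometric series with sum 8 C / n.
      Subtracting its remainder makes the sequence nondecreasing; as it tends to 0, its first term
      is at most 0.\<close>
    define a where "a j = p (2 ^ j * n) - 8 * C / real (2 ^ j * n)" for j
    have n1: "n \<ge> 1" using N[OF that] by simp
    have "a j \<le> a (Suc j)" for j
    proof -
      define k where "k = 2 ^ j * n"
      have "k \<ge> n" by (simp add: k_def)
      then have "k \<ge> N" "k \<ge> 1" using that n1 by auto
      moreover have "8 * C / real k = 8 * C / real (2 * k) + 4 * C / real k" by simp
      ultimately have "p k - 8 * C / real k \<le> p (2 * k) - 8 * C / real (2 * k)"
        using step[of k] by linarith
      then show ?thesis by (simp add: a_def k_def mult.assoc)
    qed
    then have "incseq a" by (rule incseq_SucI)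
    moreover have "a \<longlonglongrightarrow> 0"
    proof -
      have g: "filterlim (\<lambda>j. 2 ^ j * n) at_top sequentially"
      proof (rule filterlim_at_top_mono[OF filterlim_ident])
        have "j \<le> 2 ^ j * n" for j
        proof -
          have "j \<le> 2 ^ j" using less_exp[of j] by simp
          also have "\<dots> \<le> 2 ^ j * n" using n1 by simp
          finally show ?thesis .
        qed
        then show "\<forall>\<^sub>F j in sequentially. j \<le> 2 ^ j * n" by simp
      qed
      have "(\<lambda>j. p (2 ^ j * n)) \<longlonglongrightarrow> 0" by (rule filterlim_compose[OF p0 g])
      moreover have "(\<lambda>j. 8 * C / real (2 ^ j * n)) \<longlonglongrightarrow> 0"
        by (rule filterlim_compose[OF lim_const_over_n g])
      ultimately have "a \<longlonglongrightarrow> 0 - 0" unfolding a_def by (rule tendsto_diff)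
      then show ?thesis by simp
    qed
    ultimately have "a 0 \<le> 0" by (rule incseq_le)
    then show ?thesis using n1 by (simp add: a_def field_simps)
  qed
  show thesis
  proof (rule that[of C "max N 1"])
    show "C > 0" using C'(1) by (simp add: C_def)
  qed (use Lpos L2 G tail in \<open>auto simp: G_def p_def\<close>)
qed

text \<open>Truncation at the level belonging to 2^j n: some of the \<open>n\<close> observations
  exceeds it with probability at most 8 C / 2^j, made small by the choice of \<open>j\<close>. Below
  it, Markov's inequality applies, at the price of the fixed factor 4^j in the second
  moment.\<close>

lemma sum_squares_tight:
  assumes int: "integrable M (X 0)"
    and L: "DAN_factor M X L" and \<delta>: "\<delta> > 0"
  obtains K where
    "\<forall>\<^sub>F n in sequentially. measure M {\<omega> \<in> space M. (\<Sum>i<n. (X i \<omega>)\<^sup>2) / (real n * (L (real n))\<^sup>2) > K} \<le> \<delta>"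
proof -
  interpret F: real_distribution F by (rule real_distribution_F)
  define B where "B n = sqrt (real n) * L (real n)" for n
  obtain C N where C: "C > 0" and N: "N \<ge> 1"
    and Lpos: "\<And>n. n \<ge> N \<Longrightarrow> L (real n) > 0"
    and L2: "\<And>n. n \<ge> N \<Longrightarrow> L (real (2 * n)) \<le> 2 * L (real n)"
    and G: "\<And>n. n \<ge> N \<Longrightarrow> (\<integral>x. (if \<bar>x\<bar> \<le> B n then x\<^sup>2 else 0) \<partial>F) \<le> C * (L (real n))\<^sup>2"
    and tail: "\<And>n. n \<ge> N \<Longrightarrow> real n * measure F {x. \<bar>x\<bar> > B n} \<le> 8 * C"
    using DAN_tail_bounds[OF int L] unfolding B_def by blast
  have "(\<lambda>j. 8 * C / 2 ^ j) \<longlonglongrightarrow> 0"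
    using tendsto_mult[OF tendsto_const[of "8 * C"] LIMSEQ_power_zero[of "1 / 2 :: real"]]
    by (simp add: power_divide)
  then have "\<forall>\<^sub>F j in sequentially. 8 * C / 2 ^ j < \<delta> / 2"
    by (rule order_tendstoD(2)) (use \<delta> in simp)
  then obtain j where j: "8 * C / 2 ^ j < \<delta> / 2"
    using eventually_happens'[OF sequentially_bot] by blast
  have Lj: "L (real (2 ^ i * n)) \<le> 2 ^ i * L (real n)" if "n \<ge> N" for n i
  proof (induction i)
    case (Suc i)
    have "2 ^ i * n \<ge> N" using that by (metis le_trans mult_le_mono1 nat_mult_1 one_le_numeral one_le_power)
    from L2[OF this] have "L (real (2 ^ Suc i * n)) \<le> 2 * L (real (2 ^ i * n))"
      by (simp add: mult.assoc)
    also have "\<dots> \<le> 2 ^ Suc i * L (real n)" using Suc by simp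
    finally show ?case .
  qed simp
  \<comment> \<open>Chosen so that Markov's inequality for the truncated sum yields exactly \<delta>
    / 2.\<close>
  define K where "K = 2 * C * (2 ^ j)\<^sup>2 / \<delta>"
  have K0: "K > 0" using C \<delta> by (simp add: K_def)
  have "\<forall>\<^sub>F n in sequentially. measure M {\<omega> \<in> space M. (\<Sum>i<n. (X i \<omega>)\<^sup>2) / (real n * (L (real n))\<^sup>2) > K} \<le> \<delta>"
    using eventually_ge_at_top[of N]
  proof eventually_elim
    case (elim n)
    define n' where "n' = 2 ^ j * n"
    have n': "n' \<ge> N" using elim unfolding n'_def
      by (metis le_trans mult_le_mono1 nat_mult_1 one_le_numeral one_le_power)
    have n0: "real n > 0" using elim N by simp
    note L0 = Lpos[OF elim]
    define f where "f x = (if \<bar>x\<bar> \<le> B n' then x\<^sup>2 else 0)" for x :: real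
    have [measurable]: "f \<in> borel_measurable borel" unfolding f_def by measurable
    have "norm (f x) \<le> (B n')\<^sup>2" for x :: real
      using power_mono[of "\<bar>x\<bar>" "B n'" 2] by (simp add: f_def)
    then have fint: "integrable M (\<lambda>\<omega>. f (X i \<omega>))" for i
      by (intro integrable_const_bound[of _ "(B n')\<^sup>2"] AE_I2) auto
    have fF: "(\<integral>\<omega>. f (X i \<omega>) \<partial>M) = integral\<^sup>L F f" for i
      by (rule integral_F) measurable
    have f0: "f x \<ge> 0" for x by (simp add: f_def)
    define E1 where "E1 = (\<Union>i<n. {\<omega> \<in> space M. \<bar>X i \<omega>\<bar> > B n'})"
    define E2 where "E2 = {\<omega> \<in> space M. (\<Sum>i<n. f (X i \<omega>)) > K * (real n * (L (real n))\<^sup>2)}"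
    have Em: "E1 \<in> sets M" "E2 \<in> sets M" unfolding E1_def E2_def by measurable
    have "measure M {\<omega> \<in> space M. (\<Sum>i<n. (X i \<omega>)\<^sup>2) / (real n * (L (real n))\<^sup>2) > K} \<le> measure M (E1 \<union> E2)"
    proof (rule finite_measure_mono)
      show "{\<omega> \<in> space M. (\<Sum>i<n. (X i \<omega>)\<^sup>2) / (real n * (L (real n))\<^sup>2) > K} \<subseteq> E1 \<union> E2"
      proof safe
        fix \<omega> assume \<omega>: "\<omega> \<in> space M" "(\<Sum>i<n. (X i \<omega>)\<^sup>2) / (real n * (L (real n))\<^sup>2) > K" "\<omega> \<notin> E2"
        show "\<omega> \<in> E1"
        proof (rule ccontr)
          assume "\<omega> \<notin> E1"
          then have "(\<Sum>i<n. (X i \<omega>)\<^sup>2) = (\<Sum>i<n. f (X i \<omega>))"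
            using \<omega>(1) by (intro sum.cong) (auto simp: E1_def f_def not_less)
          then show False using \<omega> n0 L0 by (simp add: E2_def less_divide_eq)
        qed
      qed
    qed (use Em in simp)
    also have "\<dots> \<le> measure M E1 + measure M E2" by (rule measure_Un_le) (rule Em)+
    also have "measure M E1 \<le> \<delta> / 2"
    proof -
      have "measure M E1 \<le> (\<Sum>i<n. measure M {\<omega> \<in> space M. \<bar>X i \<omega>\<bar> > B n'})"
        unfolding E1_def by (intro finite_measure_subadditive_finite) auto
      also have "\<dots> = (\<Sum>i<n. measure F {x. \<bar>x\<bar> > B n'})"
      proof (rule sum.cong[OF refl])
        fix i
        show "measure M {\<omega> \<in> space M. \<bar>X i \<omega>\<bar> > B n'} = measure F {x. \<bar>x\<bar> > B n'}"
          using measure_F[of "{x. \<bar>x\<bar> > B n'}" i] by simp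
      qed
      also have "\<dots> = (real n' * measure F {x. \<bar>x\<bar> > B n'}) / 2 ^ j" by (simp add: n'_def)
      also have "\<dots> \<le> 8 * C / 2 ^ j" using tail[OF n'] by (intro divide_right_mono) auto
      finally show ?thesis using j by linarith
    qed
    also have "measure M E2 \<le> \<delta> / 2"
    proof -
      have "measure M E2 \<le> (\<integral>\<omega>. (\<Sum>i<n. f (X i \<omega>)) \<partial>M) / (K * (real n * (L (real n))\<^sup>2))"
        unfolding E2_def using fint f0 K0 n0 L0
        by (intro markov_strict Bochner_Integration.integrable_sum sum_nonneg) auto
      also have "(\<integral>\<omega>. (\<Sum>i<n. f (X i \<omega>)) \<partial>M) = real n * integral\<^sup>L F f"
        using fint by (simp add: Bochner_Integration.integral_sum fF)
      also have "real n * integral\<^sup>L F f / (K * (real n * (L (real n))\<^sup>2)) = integral\<^sup>L F f / (K * (L (real n))\<^sup>2)"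
        using n0 by simp
      also have "\<dots> \<le> C * (2 ^ j * L (real n))\<^sup>2 / (K * (L (real n))\<^sup>2)"
      proof (rule divide_right_mono)
        have "(L (real n'))\<^sup>2 \<le> (2 ^ j * L (real n))\<^sup>2"
          using Lj[OF elim, of j] Lpos[OF n'] unfolding n'_def by (intro power_mono) auto
        then have "C * (L (real n'))\<^sup>2 \<le> C * (2 ^ j * L (real n))\<^sup>2" using C by simp
        with G[OF n'] show "integral\<^sup>L F f \<le> C * (2 ^ j * L (real n))\<^sup>2"
          unfolding f_def by (rule order_trans)
      qed (use K0 in simp)
      also have "\<dots> = \<delta> / 2" using L0 C \<delta> by (simp add: K_def power_mult_distrib)
      finally show ?thesis .
    qed
    finally show ?case by simp
  qed
  then show thesis by (rule that)
qed

text \<open>The expression is the square of the normalised sum divided by \<open>n\<close>, and the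
  normalised sum is tight because it converges in law.\<close>

lemma mean_negligible:
  assumes L: "DAN_factor M X L" and \<mu>: "(\<integral>\<omega>. X 0 \<omega> \<partial>M) = 0"
  shows "oP_1 M (\<lambda>n \<omega>. ((\<Sum>i<n. X i \<omega>) / real n / L (real n))\<^sup>2)"
  unfolding oP_1_def
proof (intro allI impI)
  fix \<epsilon> :: real assume \<epsilon>: "\<epsilon> > 0"
  define S where "S n \<omega> = (\<Sum>i<n. X i \<omega>) / (sqrt (real n) * L (real n))" for n \<omega>
  have [measurable]: "S n \<in> borel_measurable M" for n unfolding S_def by measurable
  interpret Z: real_distribution std_normal_distribution by (rule real_dist_normal_dist)
  define \<Phi> where "\<Phi> = cdf std_normal_distribution"
  \<comment> \<open>The normal law has no atoms, so weak convergence gives convergence of the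
    distribution functions at every point, in particular at \<open>K\<close> and
    \<open>- K\<close>.\<close>
  have cont: "isCont \<Phi> x" for x
    unfolding \<Phi>_def Z.isCont_cdf
    by (subst measure_eq_emeasure_eq_ennreal[of 0]) (auto simp: emeasure_density nn_integral_null_set)
  have conv: "(\<lambda>n. cdf (distr M borel (S n)) x) \<longlonglongrightarrow> \<Phi> x" for x
    using L cont[of x] unfolding DAN_factor_def Let_def weak_conv_m_def weak_conv_def \<Phi>_def S_def \<mu> by simp
  have cdf_S: "cdf (distr M borel (S n)) x = measure M {\<omega> \<in> space M. S n \<omega> \<le> x}" for n x
    unfolding cdf_def by (subst measure_distr) (auto intro!: arg_cong[of _ _ "measure M"])
  show "(\<lambda>n. measure M {\<omega> \<in> space M. \<bar>((\<Sum>i<n. X i \<omega>) / real n / L (real n))\<^sup>2\<bar> > \<epsilon>}) \<longlonglongrightarrow> 0"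
  proof (rule order_tendstoI)
    fix \<delta> :: real assume \<delta>: "0 < \<delta>"
    have "\<forall>\<^sub>F x in at_top. \<Phi> x > 1 - \<delta> / 4"
      using Z.cdf_lim_at_top_prob \<delta> unfolding \<Phi>_def by (intro order_tendstoD(1)) auto
    moreover have "\<forall>\<^sub>F x in at_top. \<Phi> (- x) < \<delta> / 4"
      using filterlim_compose[OF Z.cdf_lim_at_bot filterlim_uminus_at_bot_at_top] \<delta>
      unfolding \<Phi>_def by (intro order_tendstoD(2)) auto
    ultimately have "\<forall>\<^sub>F x in at_top. \<Phi> x > 1 - \<delta> / 4 \<and> \<Phi> (- x) < \<delta> / 4 \<and> x > 0"
      using eventually_gt_at_top[of 0] by eventually_elim auto
    then obtain K where K: "\<Phi> K > 1 - \<delta> / 4" "\<Phi> (- K) < \<delta> / 4" "K > 0"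
      using eventually_happens'[OF trivial_limit_at_top_linorder] by blast
    have "\<forall>\<^sub>F n in sequentially. cdf (distr M borel (S n)) K > 1 - \<delta> / 4"
      using conv K(1) by (rule order_tendstoD(1))
    moreover have "\<forall>\<^sub>F n in sequentially. cdf (distr M borel (S n)) (- K) < \<delta> / 4"
      using conv K(2) by (rule order_tendstoD(2))
    moreover have "\<forall>\<^sub>F n in sequentially. real n > K\<^sup>2 / \<epsilon>"
      using filterlim_real_sequentially by (simp add: filterlim_at_top_dense)
    ultimately show "\<forall>\<^sub>F n in sequentially.
        measure M {\<omega> \<in> space M. \<bar>((\<Sum>i<n. X i \<omega>) / real n / L (real n))\<^sup>2\<bar> > \<epsilon>} < \<delta>"
      using eventually_gt_at_top[of 0]
    proof eventually_elim
      case (elim n)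
      have eq: "((\<Sum>i<n. X i \<omega>) / real n / L (real n))\<^sup>2 = (S n \<omega>)\<^sup>2 / real n" for \<omega>
        using elim by (simp add: S_def power_divide power_mult_distrib power2_eq_square)
      define E1 where "E1 = {\<omega> \<in> space M. S n \<omega> \<le> - K}"
      define E2 where "E2 = {\<omega> \<in> space M. S n \<omega> \<le> K}"
      have Em: "E1 \<in> sets M" "E2 \<in> sets M" unfolding E1_def E2_def by measurable
      have "measure M {\<omega> \<in> space M. \<bar>((\<Sum>i<n. X i \<omega>) / real n / L (real n))\<^sup>2\<bar> > \<epsilon>}
          \<le> measure M (E1 \<union> (space M - E2))"
      proof (rule finite_measure_mono)
        show "{\<omega> \<in> space M. \<bar>((\<Sum>i<n. X i \<omega>) / real n / L (real n))\<^sup>2\<bar> > \<epsilon>} \<subseteq> E1 \<union> (space M - E2)"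
        proof
          fix \<omega> assume "\<omega> \<in> {\<omega> \<in> space M. \<bar>((\<Sum>i<n. X i \<omega>) / real n / L (real n))\<^sup>2\<bar> > \<epsilon>}"
          then have \<omega>: "\<omega> \<in> space M" "(S n \<omega>)\<^sup>2 / real n > \<epsilon>" unfolding eq by auto
          have "K\<^sup>2 < \<epsilon> * real n" using elim \<epsilon> by (simp add: divide_less_eq mult.commute)
          also have "\<dots> < (S n \<omega>)\<^sup>2" using \<omega>(2) elim by (simp add: less_divide_eq)
          finally have "K < \<bar>S n \<omega>\<bar>" using K(3) abs_le_square_iff[of "S n \<omega>" K] by (simp add: not_le[symmetric])
          then show "\<omega> \<in> E1 \<union> (space M - E2)" using \<omega>(1) by (auto simp: E1_def E2_def)
        qed
      qed (use Em in auto)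
      also have "\<dots> \<le> measure M E1 + measure M (space M - E2)"
        using Em by (intro measure_Un_le) auto
      also have "measure M (space M - E2) = 1 - measure M E2" using Em by (intro prob_compl)
      finally show ?case using elim \<delta> unfolding cdf_S E1_def[symmetric] E2_def[symmetric] by linarith
    qed
  qed (rule always_eventually, simp add: less_le_trans[OF _ measure_nonneg])
qed

end

section \<open>The jackknife variance\<close>

text \<open>Fubini verifies the defining property of the conditional expectation on the events
  generated by \<open>X 0\<close>. The conclusion is stated under the law \<open>F\<close> so that
  it can be transferred from \<open>X 0\<close> to every observation.\<close>

lemma (in iid_sample) cond_exp_given_proj1:
  assumes g [measurable]: "g \<in> borel_measurable (borel \<Otimes>\<^sub>M Rpow k)"
    and int: "integrable (F \<Otimes>\<^sub>M Fpow k) g"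
    and A: "finite A" "0 \<notin> A" "card A = k"
    and h1: "cond_exp_given M (\<lambda>\<omega>. g (X 0 \<omega>, tup A \<omega>) - \<theta>) (X 0) h1"
  shows "AE x in F. h1 x = proj1 k g x - \<theta>"
proof -
  interpret G: prob_space "Fpow k" by (rule prob_space_Fpow)
  interpret F: prob_space F by (rule prob_space_F)
  interpret FG: pair_prob_space F "Fpow k" ..
  define V where "V = vimage_algebra (space M) (X 0) borel"
  have X_in: "X 0 \<in> space M \<rightarrow> space borel" by simp
  have sub: "subalgebra M V"
    unfolding subalgebra_def V_def sets_vimage_algebra2[OF X_in]
    using measurable_X[of 0] by (auto simp: measurable_sets)
  interpret V: finite_measure_subalgebra M V by unfold_locales (rule sub)
  note [measurable] = measurable_proj1[OF g] measurable_tup[OF A(3)]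
  have h1m [measurable]: "h1 \<in> borel_measurable borel" using h1 by (simp add: cond_exp_given_def)
  define Z where "Z \<omega> = g (X 0 \<omega>, tup A \<omega>) - \<theta>" for \<omega>
  have gi: "integrable M (\<lambda>\<omega>. g (X 0 \<omega>, tup A \<omega>))"
    using integral_X_tup(2)[OF A g] int by simp
  note pi = integral_proj1[OF g int, of 0]
  have "AE \<omega> in M. real_cond_exp M V Z \<omega> = proj1 k g (X 0 \<omega>) - \<theta>"
  proof (rule V.real_cond_exp_charact)
    show "integrable M Z" unfolding Z_def using gi by simp
    show "integrable M (\<lambda>\<omega>. proj1 k g (X 0 \<omega>) - \<theta>)" using pi(1) by simp
    have "X 0 \<in> borel_measurable V" unfolding V_def by (rule measurable_vimage_algebra1[OF X_in])
    then show "(\<lambda>\<omega>. proj1 k g (X 0 \<omega>) - \<theta>) \<in> borel_measurable V" by measurable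
    fix S assume "S \<in> sets V"
    then obtain D where D [measurable]: "D \<in> sets borel" and S: "S = X 0 -` D \<inter> space M"
      unfolding V_def sets_vimage_algebra2[OF X_in] by blast
    \<comment> \<open>Absorbing the event into the kernel turns an integral over \<open>S\<close>
      into the integral of a function of the observation and its block.\<close>
    define w where "w z = indicator D (fst z) * (g z - \<theta>)" for z
    have wm [measurable]: "w \<in> borel_measurable (borel \<Otimes>\<^sub>M Rpow k)" unfolding w_def by measurable
    note [measurable] = measurable_proj1[OF wm]
    have wi: "integrable (F \<Otimes>\<^sub>M Fpow k) w"
    proof (rule Bochner_Integration.integrable_bound[of _ "\<lambda>z. g z - \<theta>"])
      show "integrable (F \<Otimes>\<^sub>M Fpow k) (\<lambda>z. g z - \<theta>)" using int by simp
    qed (auto simp: w_def indicator_def)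
    have "AE x in F. proj1 k w x = indicator D x * (proj1 k g x - \<theta>)"
      using FG.AE_integrable_fst'[OF int]
    proof eventually_elim
      case (elim x)
      then show ?case by (simp add: proj1_def w_def G.prob_space)
    qed
    then have "AE x in distr M borel (X 0). proj1 k w x = indicator D x * (proj1 k g x - \<theta>)"
      unfolding distr_X .
    then have pw: "AE \<omega> in M. proj1 k w (X 0 \<omega>) = indicator D (X 0 \<omega>) * (proj1 k g (X 0 \<omega>) - \<theta>)"
      using measurable_proj1[OF wm] by (subst (asm) AE_distr_iff) auto
    have ind: "indicator S \<omega> = (indicator D (X 0 \<omega>) :: real)" if "\<omega> \<in> space M" for \<omega>
      using that by (simp add: S indicator_def)
    have "(\<integral>\<omega>\<in>S. Z \<omega> \<partial>M) = (\<integral>\<omega>. w (X 0 \<omega>, tup A \<omega>) \<partial>M)"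
      unfolding set_lebesgue_integral_def
      by (intro Bochner_Integration.integral_cong) (auto simp: ind w_def Z_def)
    also have "\<dots> = integral\<^sup>L (F \<Otimes>\<^sub>M Fpow k) w" by (rule integral_X_tup(1)[OF A wm])
    also have "\<dots> = (\<integral>\<omega>. proj1 k w (X 0 \<omega>) \<partial>M)"
      by (rule integral_proj1(2)[OF wm wi, symmetric])
    also have "\<dots> = (\<integral>\<omega>. indicator D (X 0 \<omega>) * (proj1 k g (X 0 \<omega>) - \<theta>) \<partial>M)"
      using pw measurable_proj1[OF wm] by (intro integral_cong_AE) auto
    also have "\<dots> = (\<integral>\<omega>\<in>S. proj1 k g (X 0 \<omega>) - \<theta> \<partial>M)"
      unfolding set_lebesgue_integral_def
      by (intro Bochner_Integration.integral_cong) (auto simp: ind)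
    finally show "(\<integral>\<omega>\<in>S. Z \<omega> \<partial>M) = (\<integral>\<omega>\<in>S. proj1 k g (X 0 \<omega>) - \<theta> \<partial>M)" .
  qed
  moreover have "AE \<omega> in M. h1 (X 0 \<omega>) = real_cond_exp M V Z \<omega>"
    using h1 unfolding cond_exp_given_def V_def Z_def by simp
  ultimately have "AE \<omega> in M. h1 (X 0 \<omega>) = proj1 k g (X 0 \<omega>) - \<theta>"
    by eventually_elim simp
  then have "AE x in distr M borel (X 0). h1 x = proj1 k g x - \<theta>"
    by (subst AE_distr_iff) auto
  then show ?thesis unfolding distr_X .
qed

lemma (in iid_sample) AE_F_all:
  assumes "AE x in F. P x" and "{x. P x} \<in> sets borel"
  shows "AE \<omega> in M. \<forall>i\<in>{..<n}. P (X i \<omega>)"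
proof -
  have "AE \<omega> in M. P (X i \<omega>)" for i
    using assms unfolding distr_X[of i, symmetric] by (subst (asm) AE_distr_iff) auto
  then show ?thesis by (intro AE_finite_allI) auto
qed

lemma (in finite_measure) oP_1_cong_AE:
  assumes Y: "oP_1 M Y" "\<And>n. Y n \<in> borel_measurable M"
    and eq: "\<And>n. AE \<omega> in M. Z n \<omega> = Y n \<omega>"
  shows "oP_1 M Z"
  unfolding oP_1_def
proof (intro allI impI)
  fix \<epsilon> :: real assume "\<epsilon> > 0"
  then have lim: "(\<lambda>n. measure M {\<omega> \<in> space M. \<bar>Y n \<omega>\<bar> > \<epsilon>}) \<longlonglongrightarrow> 0"
    using Y(1) by (simp add: oP_1_def)
  have "measure M {\<omega> \<in> space M. \<bar>Z n \<omega>\<bar> > \<epsilon>} \<le> measure M {\<omega> \<in> space M. \<bar>Y n \<omega>\<bar> > \<epsilon>}" for n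
    using Y(2)[of n] eq[of n] by (intro finite_measure_mono_AE) auto
  then show "(\<lambda>n. measure M {\<omega> \<in> space M. \<bar>Z n \<omega>\<bar> > \<epsilon>}) \<longlonglongrightarrow> 0"
    by (intro tendsto_sandwich[OF _ _ tendsto_const lim]) auto
qed

section \<open>Comparison of sums of squares for a fixed sample\<close>

lemma sum_square_perturbation:
  fixes a b :: "'i \<Rightarrow> real"
  shows "\<bar>(\<Sum>i\<in>I. (a i + b i)\<^sup>2) - (\<Sum>i\<in>I. (a i)\<^sup>2)\<bar>
    \<le> (\<Sum>i\<in>I. (b i)\<^sup>2) + 2 * sqrt ((\<Sum>i\<in>I. (a i)\<^sup>2) * (\<Sum>i\<in>I. (b i)\<^sup>2))"
proof -
  have eq: "(\<Sum>i\<in>I. (a i + b i)\<^sup>2) - (\<Sum>i\<in>I. (a i)\<^sup>2) = (\<Sum>i\<in>I. (b i)\<^sup>2) + 2 * (\<Sum>i\<in>I. a i * b i)"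
    by (simp add: power2_sum sum.distrib sum_distrib_left mult.assoc)
  have "\<bar>\<Sum>i\<in>I. a i * b i\<bar> \<le> (\<Sum>i\<in>I. \<bar>a i\<bar> * \<bar>b i\<bar>)"
    using sum_abs[of "\<lambda>i. a i * b i" I] by (simp add: abs_mult)
  also have "\<dots> \<le> L2_set a I * L2_set b I" by (rule L2_set_mult_ineq)
  finally have "\<bar>\<Sum>i\<in>I. a i * b i\<bar> \<le> sqrt ((\<Sum>i\<in>I. (a i)\<^sup>2) * (\<Sum>i\<in>I. (b i)\<^sup>2))"
    by (simp add: L2_set_def real_sqrt_mult)
  moreover have "(\<Sum>i\<in>I. (b i)\<^sup>2) \<ge> 0" by (simp add: sum_nonneg)
  ultimately show ?thesis unfolding eq by linarith
qed

text \<open>Subtracting the mean can only lower a sum of squares; the further shift by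
  \<open>s\<close> costs a factor 2.\<close>

lemma sum_centred_squares_le:
  fixes r :: "nat \<Rightarrow> real"
  assumes "n > 0"
  shows "(\<Sum>i<n. (r i - (\<Sum>i<n. r i) / real n - s)\<^sup>2) \<le> 2 * (\<Sum>i<n. (r i)\<^sup>2) + 2 * (real n * s\<^sup>2)"
proof -
  define \<rho> where "\<rho> = (\<Sum>i<n. r i) / real n"
  have \<rho>: "(\<Sum>i<n. r i) = real n * \<rho>" using assms by (simp add: \<rho>_def)
  have "(\<Sum>i<n. (r i - \<rho>)\<^sup>2) = (\<Sum>i<n. (r i)\<^sup>2) - 2 * \<rho> * (\<Sum>i<n. r i) + real n * \<rho>\<^sup>2"
    by (simp add: power2_diff sum.distrib sum_subtractf sum_distrib_left mult_ac)
  also have "\<dots> = (\<Sum>i<n. (r i)\<^sup>2) - real n * \<rho>\<^sup>2" by (simp add: \<rho> power2_eq_square)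
  finally have 1: "(\<Sum>i<n. (r i - \<rho>)\<^sup>2) \<le> (\<Sum>i<n. (r i)\<^sup>2)" by simp
  have "(\<Sum>i<n. (r i - \<rho> - s)\<^sup>2) \<le> (\<Sum>i<n. 2 * (r i - \<rho>)\<^sup>2 + 2 * s\<^sup>2)"
  proof (rule sum_mono)
    show "(r i - \<rho> - s)\<^sup>2 \<le> 2 * (r i - \<rho>)\<^sup>2 + 2 * s\<^sup>2" for i
      using zero_le_power2[of "(r i - \<rho>) + s"] power2_sum[of "r i - \<rho>" s] power2_diff[of "r i - \<rho>" s]
      by linarith
  qed
  also have "\<dots> = 2 * (\<Sum>i<n. (r i - \<rho>)\<^sup>2) + 2 * (real n * s\<^sup>2)"
    by (simp add: sum.distrib sum_distrib_left)
  finally show ?thesis using 1 unfolding \<rho>_def by linarith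
qed

text \<open>The deterministic core, for arbitrary numbers \<open>a i\<close> in place of the
  projections. \<open>c\<close> is what remains of the normalisation after the factor m / (n - m)
  has been squared, \<open>V\<close> is the target sum, and \<open>W\<close> bounds the normalised
  squared error.\<close>

lemma jackknife_variance_bound:
  fixes x a :: "nat \<Rightarrow> real" and \<theta> :: real
  assumes sym: "symmetric_kernel m h" and m: "1 \<le> m" "m < n" and l: "l > 0"
  defines "c \<equiv> real n * (real n - 1) / (real n - real m)\<^sup>2"
  defines "V \<equiv> (\<Sum>i<n. (a i)\<^sup>2) / (real n * l\<^sup>2)"
  defines "W \<equiv> 2 * ((\<Sum>i<n. (local_mean m h x n i - \<theta> - a i)\<^sup>2) / real n) / l\<^sup>2
      + 2 * ((\<Sum>i<n. a i) / real n / l)\<^sup>2"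
  shows "\<bar>(real n - 1) / ((real m)\<^sup>2 * l\<^sup>2) * (\<Sum>i<n. (U_jack m h x n i - U_stat m h x n)\<^sup>2)
      - 1 / (real n * l\<^sup>2) * (\<Sum>i<n. (a i)\<^sup>2)\<bar> \<le> \<bar>c - 1\<bar> * V + c * (W + 2 * sqrt (V * W))"
proof -
  define q where "q = local_mean m h x n"
  define U where "U = U_stat m h x n"
  define r where "r i = q i - \<theta> - a i" for i
  define A where "A = (\<Sum>i<n. a i) / real n"
  \<comment> \<open>As \<open>U\<close> is the mean of the \<open>q i\<close>, this is exactly
    \<open>q i - U - a i\<close>; the constant \<theta> cancels.\<close>
  define b where "b i = r i - (\<Sum>i<n. r i) / real n - A" for i
  define t where "t = real n * l\<^sup>2"
  have n0: "real n > 0" using m by simp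
  have t0: "t > 0" using n0 l by (simp add: t_def)
  have mn: "real n - real m > 0" using m by simp
  have c0: "c \<ge> 0" using m by (simp add: c_def)
  have "real n * U = (\<Sum>i<n. q i)" unfolding U_def q_def by (rule U_stat_eq_mean(1)[OF sym m])
  then have U: "U = (\<Sum>i<n. r i) / real n + A + \<theta>"
    using n0 by (simp add: r_def A_def sum_subtractf sum.distrib field_simps)
  have qU: "q i - U = a i + b i" for i by (simp add: b_def U r_def)
  have "(\<Sum>i<n. (U_jack m h x n i - U)\<^sup>2) = (\<Sum>i<n. (real m)\<^sup>2 / (real n - real m)\<^sup>2 * (a i + b i)\<^sup>2)"
  proof (rule sum.cong[OF refl])
    fix i assume "i \<in> {..<n}"
    then have "U_jack m h x n i - U = real m / (real n - real m) * (U - q i)"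
      using U_stat_eq_mean(2)[OF sym m, of i x] m by (simp add: U_def q_def)
    then have "(U_jack m h x n i - U)\<^sup>2 = (real m / (real n - real m))\<^sup>2 * (q i - U)\<^sup>2"
      by (simp only: power_mult_distrib power2_commute[of U])
    then show "(U_jack m h x n i - U)\<^sup>2 = (real m)\<^sup>2 / (real n - real m)\<^sup>2 * (a i + b i)\<^sup>2"
      by (simp add: qU power_divide)
  qed
  also have "\<dots> = (real m)\<^sup>2 / (real n - real m)\<^sup>2 * (\<Sum>i<n. (a i + b i)\<^sup>2)"
    by (simp add: sum_distrib_left)
  finally have "(real n - 1) / ((real m)\<^sup>2 * l\<^sup>2) * (\<Sum>i<n. (U_jack m h x n i - U)\<^sup>2)
      = (real n - 1) / ((real m)\<^sup>2 * l\<^sup>2) * ((real m)\<^sup>2 / (real n - real m)\<^sup>2 * (\<Sum>i<n. (a i + b i)\<^sup>2))"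
    by simp
  also have "\<dots> = c * ((\<Sum>i<n. (a i + b i)\<^sup>2) / t)"
    using m n0 l mn by (simp add: c_def t_def)
  finally have main: "(real n - 1) / ((real m)\<^sup>2 * l\<^sup>2) * (\<Sum>i<n. (U_jack m h x n i - U)\<^sup>2)
      - 1 / (real n * l\<^sup>2) * (\<Sum>i<n. (a i)\<^sup>2)
      = (c - 1) * V + c * (((\<Sum>i<n. (a i + b i)\<^sup>2) - (\<Sum>i<n. (a i)\<^sup>2)) / t)"
    by (simp add: V_def t_def diff_divide_distrib algebra_simps)
  have V0: "V \<ge> 0" unfolding V_def t_def[symmetric] using t0 by (simp add: sum_nonneg)
  have bW: "(\<Sum>i<n. (b i)\<^sup>2) / t \<le> W"
  proof -
    have "(\<Sum>i<n. (b i)\<^sup>2) / t \<le> (2 * (\<Sum>i<n. (r i)\<^sup>2) + 2 * (real n * A\<^sup>2)) / t"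
      using sum_centred_squares_le[of n r A] m t0 unfolding b_def by (intro divide_right_mono) auto
    also have "\<dots> = 2 * ((\<Sum>i<n. (r i)\<^sup>2) / real n) / l\<^sup>2 + 2 * (A / l)\<^sup>2"
      using n0 l by (simp add: t_def add_divide_distrib power_divide)
    finally show ?thesis by (simp add: W_def r_def q_def A_def)
  qed
  have "\<bar>((\<Sum>i<n. (a i + b i)\<^sup>2) - (\<Sum>i<n. (a i)\<^sup>2)) / t\<bar>
      \<le> ((\<Sum>i<n. (b i)\<^sup>2) + 2 * sqrt ((\<Sum>i<n. (a i)\<^sup>2) * (\<Sum>i<n. (b i)\<^sup>2))) / t"
    using t0 sum_square_perturbation[of a b "{..<n}"] by (simp add: abs_divide divide_right_mono)
  also have "\<dots> = (\<Sum>i<n. (b i)\<^sup>2) / t + 2 * sqrt (V * ((\<Sum>i<n. (b i)\<^sup>2) / t))"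
    using t0 by (simp add: V_def t_def[symmetric] add_divide_distrib real_sqrt_divide)
  also have "\<dots> \<le> W + 2 * sqrt (V * W)"
    using mult_left_mono[OF bW V0] bW V0 by (intro add_mono mult_left_mono real_sqrt_le_mono) auto
  finally have "\<bar>((\<Sum>i<n. (a i + b i)\<^sup>2) - (\<Sum>i<n. (a i)\<^sup>2)) / t\<bar> \<le> W + 2 * sqrt (V * W)" .
  then have "\<bar>c * (((\<Sum>i<n. (a i + b i)\<^sup>2) - (\<Sum>i<n. (a i)\<^sup>2)) / t)\<bar> \<le> c * (W + 2 * sqrt (V * W))"
    unfolding abs_mult abs_of_nonneg[OF c0] using c0 by (rule mult_left_mono)
  moreover have "\<bar>(c - 1) * V\<bar> = \<bar>c - 1\<bar> * V" using V0 by (simp add: abs_mult)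
  ultimately show ?thesis using main unfolding U_def by linarith
qed

text \<open>By symmetry the distinguished index may be put in position 0 whatever its rank in the
  set, with its companions in increasing order after it.\<close>

lemma (in iid_sample) local_mean_eq_loc_avg:
  assumes sym: "symmetric_kernel m h" and m: "1 \<le> m"
  shows "local_mean m h (\<lambda>k. X k \<omega>) n i
    = loc_avg (m - 1) (\<lambda>z. h (\<lambda>k\<in>{..<m}. if k = 0 then fst z else snd z (k - 1))) n i \<omega>"
proof -
  have "set_kernel m h (\<lambda>k. X k \<omega>) (insert i A)
      = h (\<lambda>k\<in>{..<m}. if k = 0 then X i \<omega> else tup A \<omega> (k - 1))" if "A \<in> others n i (m - 1)" for A
  proof -
    have A: "finite A" "i \<notin> A" "card A = m - 1" using othersD[OF that] by auto
    \<comment> \<open>Enumerates \<open>insert i A\<close> with \<open>i\<close> first, in general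
      not in increasing order.\<close>
    define e where "e k = (if k = 0 then i else sorted_list_of_set A ! (k - 1))" for k
    have "bij_betw (\<lambda>k. sorted_list_of_set A ! k) {..<m - 1} A"
      using A by (intro bij_betw_nth) auto
    moreover have "bij_betw (\<lambda>k. k - 1) {1..<m} {..<m - 1}"
      by (rule bij_betw_byWitness[where f' = Suc]) auto
    ultimately have "bij_betw ((\<lambda>k. sorted_list_of_set A ! k) \<circ> (\<lambda>k. k - 1)) {1..<m} A"
      by (rule bij_betw_trans[rotated])
    then have "bij_betw e {1..<m} A"
      by (rule bij_betw_cong[THEN iffD1, rotated]) (simp add: e_def)
    then have "bij_betw e ({1..<m} \<union> {0}) (A \<union> {e 0})"
      using A by (intro notIn_Un_bij_betw) (auto simp: e_def)
    moreover have "{1..<m} \<union> {0} = {..<m}" using m by auto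
    ultimately have "bij_betw e {..<m} (insert i A)" by (simp add: e_def)
    from set_kernel_bij[OF sym this]
    have "set_kernel m h (\<lambda>k. X k \<omega>) (insert i A) = h (\<lambda>k\<in>{..<m}. X (e k) \<omega>)" .
    also have "(\<lambda>k\<in>{..<m}. X (e k) \<omega>) = (\<lambda>k\<in>{..<m}. if k = 0 then X i \<omega> else tup A \<omega> (k - 1))"
      using A(3) by (auto simp: fun_eq_iff e_def tup_def)
    finally show ?thesis .
  qed
  then have "(\<Sum>A\<in>others n i (m - 1). set_kernel m h (\<lambda>k. X k \<omega>) (insert i A))
      = (\<Sum>A\<in>others n i (m - 1). h (\<lambda>k\<in>{..<m}. if k = 0 then X i \<omega> else tup A \<omega> (k - 1)))"
    by (rule sum.cong[OF refl])
  then show ?thesis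
    unfolding local_mean_def loc_avg_def others_def fst_conv snd_conv by simp
qed

lemma tendsto_jackknife_constant:
  "(\<lambda>n. real n * (real n - 1) / (real n - real m)\<^sup>2) \<longlonglongrightarrow> 1"
proof -
  have inv: "(\<lambda>n. a / real n) \<longlonglongrightarrow> 0" for a by (rule lim_const_over_n)
  have "(\<lambda>n. (1 - 1 / real n) / (1 - real m / real n)\<^sup>2) \<longlonglongrightarrow> (1 - 0) / (1 - 0)\<^sup>2"
    by (intro tendsto_divide tendsto_power tendsto_diff tendsto_const inv) simp
  moreover have "\<forall>\<^sub>F n in sequentially. (1 - 1 / real n) / (1 - real m / real n)\<^sup>2
      = real n * (real n - 1) / (real n - real m)\<^sup>2"
    using eventually_gt_at_top[of 0]
  proof eventually_elim
    case (elim n)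
    have "1 - 1 / real n = (real n - 1) / real n" "1 - real m / real n = (real n - real m) / real n"
      using elim by (simp_all add: diff_divide_distrib)
    then show ?case using elim by (simp add: power_divide power2_eq_square)
  qed
  ultimately show ?thesis by (simp add: tendsto_cong)
qed

theorem theorem1:
  fixes M :: "'a measure"
    and X :: "nat \<Rightarrow> 'a \<Rightarrow> real"
    and F :: "real measure"
    and m :: nat
    and h :: "(nat \<Rightarrow> real) \<Rightarrow> real"
    and \<theta> :: real
    and h1 :: "real \<Rightarrow> real"
    and L :: "real \<Rightarrow> real"
  assumes prob: "prob_space M"
    and m: "m \<ge> 1"
    and X_indep: "prob_space.indep_vars M (\<lambda>_. borel) X UNIV"
    and X_distrib: "\<And>i. distr M borel (X i) = F"
    and X_nondeg: "\<not> (\<exists>c. AE \<omega> in M. X 0 \<omega> = c)"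
    and h_measurable: "h \<in> borel_measurable (Pi\<^sub>M {..<m} (\<lambda>_. borel))"
    and h_symmetric: "symmetric_kernel m h"
    and h_integrable: "integrable M (\<lambda>\<omega>. h (\<lambda>k\<in>{..<m}. X k \<omega>))"
    and \<theta>: "\<theta> = (\<integral>\<omega>. h (\<lambda>k\<in>{..<m}. X k \<omega>) \<partial>M)"
    and h_moment: "integrable M (\<lambda>\<omega>. \<bar>h (\<lambda>k\<in>{..<m}. X k \<omega>)\<bar> powr (5 / 3))"
    and h1: "cond_exp_given M (\<lambda>\<omega>. h (\<lambda>k\<in>{..<m}. X k \<omega>) - \<theta>) (X 0) h1"
    and h1_DAN: "DAN M (\<lambda>i \<omega>. h1 (X i \<omega>))"
    and L: "DAN_factor M (\<lambda>i \<omega>. h1 (X i \<omega>)) L"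
  shows "oP_1 M (\<lambda>n \<omega>.
           \<bar>(real n - 1) / ((real m)\<^sup>2 * (L (real n))\<^sup>2) *
               (\<Sum>i<n. (U_jack m h (\<lambda>k. X k \<omega>) n i - U_stat m h (\<lambda>k. X k \<omega>) n)\<^sup>2)
             - 1 / (real n * (L (real n))\<^sup>2) * (\<Sum>i<n. (h1 (X i \<omega>))\<^sup>2)\<bar>)"
proof -
  define k where "k = m - 1"
  define g where "g z = h (\<lambda>j\<in>{..<m}. if j = 0 then fst z else snd z (j - 1))" for z :: "real \<times> (nat \<Rightarrow> real)"
  interpret iid_sample M X F
    using prob X_indep X_distrib by (intro iid_sample.intro iid_sample_axioms.intro) auto
  have h1m [measurable]: "h1 \<in> borel_measurable borel" using h1 by (simp add: cond_exp_given_def)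
  \<comment> \<open>The bounds from the normal limit concern the projected sample, the moment bounds
    the original one.\<close>
  interpret Y: iid_sample M "\<lambda>i \<omega>. h1 (X i \<omega>)" "distr F borel h1"
  proof (intro iid_sample.intro iid_sample_axioms.intro prob)
    show "indep_vars (\<lambda>_. borel) (\<lambda>i \<omega>. h1 (X i \<omega>)) UNIV"
      by (rule indep_vars_compose2[OF X_indep, where Y = "\<lambda>_. h1"]) simp
    show "distr M borel (\<lambda>\<omega>. h1 (X i \<omega>)) = distr F borel h1" for i
      unfolding X_distrib[of i, symmetric] by (subst distr_distr) (auto simp: comp_def)
  qed
  have gm [measurable]: "g \<in> borel_measurable (borel \<Otimes>\<^sub>M Rpow k)"
    unfolding g_def
  proof (rule measurable_compose[OF measurable_restrict h_measurable])
    fix j assume j: "j \<in> {..<m}"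
    show "(\<lambda>z. if j = 0 then fst z else snd z (j - 1)) \<in> borel_measurable (borel \<Otimes>\<^sub>M Rpow k)"
    proof (cases "j = 0")
      case False
      then have "j - 1 \<in> {..<k}" using j by (auto simp: k_def)
      then have "(\<lambda>z. snd z (j - 1)) \<in> borel_measurable (borel \<Otimes>\<^sub>M Rpow k)"
        by (intro measurable_compose[OF measurable_snd measurable_component_singleton])
      then show ?thesis using False by simp
    qed simp
  qed
  \<comment> \<open>The companions of index 0 among the first \<open>m\<close> observations, through
    which the assumptions on \<open>h\<close> become statements about \<open>g\<close> under the
    product law.\<close>
  define A0 where "A0 = {1..<m}"
  have A0: "finite A0" "0 \<notin> A0" "card A0 = k" by (auto simp: A0_def k_def)
  have hg: "h (\<lambda>k\<in>{..<m}. X k \<omega>) = g (X 0 \<omega>, tup A0 \<omega>)" for \<omega>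
  proof -
    have "(\<lambda>k\<in>{..<m}. X k \<omega>) = (\<lambda>j\<in>{..<m}. if j = 0 then X 0 \<omega> else tup A0 \<omega> (j - 1))"
      by (auto simp: fun_eq_iff tup_def A0_def)
    then show ?thesis unfolding g_def fst_conv snd_conv by simp
  qed
  have int: "integrable (F \<Otimes>\<^sub>M Fpow k) g"
    using h_integrable unfolding hg by (simp add: integral_X_tup(2)[OF A0 gm])
  have int53: "integrable (F \<Otimes>\<^sub>M Fpow k) (\<lambda>z. \<bar>g z\<bar> powr (5/3))"
    using h_moment integral_X_tup(2)[OF A0, of "\<lambda>z. \<bar>g z\<bar> powr (5/3)"] unfolding hg by simp
  have h1_proj: "AE x in F. h1 x = proj1 k g x - \<theta>"
    using h1 unfolding hg by (rule cond_exp_given_proj1[OF gm int A0])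
  note [measurable] = measurable_proj1[OF gm] measurable_loc_avg[OF gm]
  have h1_X: "AE \<omega> in M. \<forall>i\<in>{..<n}. h1 (X i \<omega>) = proj1 k g (X i \<omega>) - \<theta>" for n
    using h1_proj by (rule AE_F_all) measurable
  have h1_0: "AE \<omega> in M. h1 (X 0 \<omega>) = proj1 k g (X 0 \<omega>) - \<theta>"
    using h1_X[of 1] by eventually_elim simp
  note proj_int = integral_proj1[OF gm int, of 0]
  have Y_int: "integrable M (\<lambda>\<omega>. h1 (X 0 \<omega>))"
    using proj_int(1) by (subst integrable_cong_AE[OF _ _ h1_0]) auto
  have "(\<integral>\<omega>. h1 (X 0 \<omega>) \<partial>M) = (\<integral>\<omega>. proj1 k g (X 0 \<omega>) - \<theta> \<partial>M)"
    using h1_0 by (intro integral_cong_AE) auto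
  also have "\<dots> = integral\<^sup>L (F \<Otimes>\<^sub>M Fpow k) g - \<theta>"
    using proj_int by (simp add: prob_space)
  also have "integral\<^sup>L (F \<Otimes>\<^sub>M Fpow k) g = \<theta>"
    unfolding \<theta> hg by (rule integral_X_tup(1)[OF A0 gm, symmetric])
  finally have Y_mean: "(\<integral>\<omega>. h1 (X 0 \<omega>) \<partial>M) = 0" by simp

  define R where "R n \<omega> = (\<Sum>i<n. (local_mean m h (\<lambda>k. X k \<omega>) n i - \<theta> - h1 (X i \<omega>))\<^sup>2) / real n" for n \<omega>
  define T where "T n \<omega> = ((\<Sum>i<n. h1 (X i \<omega>)) / real n / L (real n))\<^sup>2" for n \<omega>
  define V where "V n \<omega> = (\<Sum>i<n. (h1 (X i \<omega>))\<^sup>2) / (real n * (L (real n))\<^sup>2)" for n \<omega>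
  define c where "c n = real n * (real n - 1) / (real n - real m)\<^sup>2" for n
  define D where "D n \<omega> = \<bar>(real n - 1) / ((real m)\<^sup>2 * (L (real n))\<^sup>2) *
               (\<Sum>i<n. (U_jack m h (\<lambda>k. X k \<omega>) n i - U_stat m h (\<lambda>k. X k \<omega>) n)\<^sup>2)
             - 1 / (real n * (L (real n))\<^sup>2) * (\<Sum>i<n. (h1 (X i \<omega>))\<^sup>2)\<bar>" for n \<omega>
  have loc: "local_mean m h (\<lambda>k. X k \<omega>) n i = loc_avg k g n i \<omega>" for n i \<omega>
    unfolding g_def k_def by (rule local_mean_eq_loc_avg[OF h_symmetric m])
  have Rm [measurable]: "R n \<in> borel_measurable M" for n unfolding R_def loc by measurable
  have Tm [measurable]: "T n \<in> borel_measurable M" for n unfolding T_def by measurable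
  have Vm [measurable]: "V n \<in> borel_measurable M" for n unfolding V_def by measurable
  have R0: "oP_1 M R"
  proof (rule oP_1_cong_AE[OF loc_avg_deviation_oP[OF gm int int53]])
    show "AE \<omega> in M. R n \<omega> = (\<Sum>i<n. (loc_avg k g n i \<omega> - proj1 k g (X i \<omega>))\<^sup>2) / real n" for n
      using h1_X[of n] by eventually_elim (simp add: R_def loc)
  qed measurable
  have T0: "oP_1 M T"
    unfolding T_def using Y.mean_negligible[OF L Y_mean] .
  obtain l where l: "l > 0" "\<forall>\<^sub>F n in sequentially. L (real n) \<ge> l"
    using DAN_factor_lower_bound[OF L] .
  have c1: "c \<longlonglongrightarrow> 1" unfolding c_def by (rule tendsto_jackknife_constant)
  have "oP_1 M D"
    unfolding oP_1_def
  proof (intro allI impI)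
    fix \<epsilon> :: real assume \<epsilon>: "\<epsilon> > 0"
    show "(\<lambda>n. measure M {\<omega> \<in> space M. \<bar>D n \<omega>\<bar> > \<epsilon>}) \<longlonglongrightarrow> 0"
    proof (rule order_tendstoI)
      fix \<delta> :: real assume \<delta>: "0 < \<delta>"
      obtain K' where K': "\<forall>\<^sub>F n in sequentially. measure M {\<omega> \<in> space M. V n \<omega> > K'} \<le> \<delta> / 4"
        using Y.sum_squares_tight[OF Y_int L, of "\<delta> / 4"] \<delta> unfolding V_def by auto
      \<comment> \<open>A nonnegative bound is needed under the square root and for monotonicity of
        the products.\<close>
      define K where "K = max K' 0"
      have K0: "K \<ge> 0" by (simp add: K_def)
      \<comment> \<open>With V \<le> K, W \<le> \<eta> and |c - 1| \<le> \<eta> the deterministic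
        bound is at most this expression, which vanishes with \<eta>.\<close>
      have "((\<lambda>\<eta>. \<eta> * K + (1 + \<eta>) * (\<eta> + 2 * sqrt (K * \<eta>))) \<longlongrightarrow> 0 * K + (1 + 0) * (0 + 2 * sqrt (K * 0))) (at_right 0)"
        by (intro tendsto_intros)
      then have "\<forall>\<^sub>F \<eta> in at_right 0. \<eta> * K + (1 + \<eta>) * (\<eta> + 2 * sqrt (K * \<eta>)) < \<epsilon>"
        by (rule order_tendstoD(2)) (use \<epsilon> in simp)
      then have "\<forall>\<^sub>F \<eta> in at_right 0. \<eta> * K + (1 + \<eta>) * (\<eta> + 2 * sqrt (K * \<eta>)) < \<epsilon> \<and> \<eta> > 0"
        using eventually_at_right_less[of "0::real"] by eventually_elim auto
      then obtain \<eta> where \<eta>: "\<eta> * K + (1 + \<eta>) * (\<eta> + 2 * sqrt (K * \<eta>)) < \<epsilon>" "\<eta> > 0"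
        using eventually_happens'[OF trivial_limit_at_right_real] by blast
      \<comment> \<open>The factor l^2 absorbs the division by the square of \<open>L n\<close>,
        which is eventually at least l^2; the quarters make the two terms of \<open>W\<close> at
        most \<eta> / 2 each.\<close>
      have "(\<lambda>n. measure M {\<omega> \<in> space M. \<bar>R n \<omega>\<bar> > \<eta> * l\<^sup>2 / 4}) \<longlonglongrightarrow> 0"
        using \<eta>(2) l(1) by (intro R0[unfolded oP_1_def, rule_format]) simp
      then have evR: "\<forall>\<^sub>F n in sequentially. measure M {\<omega> \<in> space M. \<bar>R n \<omega>\<bar> > \<eta> * l\<^sup>2 / 4} < \<delta> / 4"
        by (rule order_tendstoD(2)) (use \<delta> in simp)
      have "(\<lambda>n. measure M {\<omega> \<in> space M. \<bar>T n \<omega>\<bar> > \<eta> / 4}) \<longlonglongrightarrow> 0"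
        using \<eta>(2) by (intro T0[unfolded oP_1_def, rule_format]) simp
      then have evT: "\<forall>\<^sub>F n in sequentially. measure M {\<omega> \<in> space M. \<bar>T n \<omega>\<bar> > \<eta> / 4} < \<delta> / 4"
        by (rule order_tendstoD(2)) (use \<delta> in simp)
      have evc: "\<forall>\<^sub>F n in sequentially. dist (c n) 1 < \<eta>" using c1 \<eta>(2) by (rule tendstoD)
      show "\<forall>\<^sub>F n in sequentially. measure M {\<omega> \<in> space M. \<bar>D n \<omega>\<bar> > \<epsilon>} < \<delta>"
        using K' evR evT evc l(2) eventually_gt_at_top[of m]
      proof eventually_elim
        case (elim n)
        have L0: "L (real n) > 0" using elim(5) l(1) by linarith
        define E1 where "E1 = {\<omega> \<in> space M. V n \<omega> > K'}"
        define E2 where "E2 = {\<omega> \<in> space M. \<bar>R n \<omega>\<bar> > \<eta> * l\<^sup>2 / 4}"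
        define E3 where "E3 = {\<omega> \<in> space M. \<bar>T n \<omega>\<bar> > \<eta> / 4}"
        have Em: "E1 \<in> sets M" "E2 \<in> sets M" "E3 \<in> sets M"
          unfolding E1_def E2_def E3_def by measurable
        have "measure M {\<omega> \<in> space M. \<bar>D n \<omega>\<bar> > \<epsilon>} \<le> measure M (E1 \<union> (E2 \<union> E3))"
        proof (rule finite_measure_mono)
          show "{\<omega> \<in> space M. \<bar>D n \<omega>\<bar> > \<epsilon>} \<subseteq> E1 \<union> (E2 \<union> E3)"
          proof (rule subsetI, rule ccontr)
            fix \<omega> assume D: "\<omega> \<in> {\<omega> \<in> space M. \<bar>D n \<omega>\<bar> > \<epsilon>}" and notin: "\<omega> \<notin> E1 \<union> (E2 \<union> E3)"
            define W where "W = 2 * R n \<omega> / (L (real n))\<^sup>2 + 2 * T n \<omega>"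
            have VK: "V n \<omega> \<le> K" and Rl: "R n \<omega> \<le> \<eta> * l\<^sup>2 / 4" and Tl: "T n \<omega> \<le> \<eta> / 4"
              using D notin by (auto simp: E1_def E2_def E3_def K_def not_less)
            have V0: "V n \<omega> \<ge> 0" by (simp add: V_def sum_nonneg)
            have Rn: "R n \<omega> \<ge> 0" by (simp add: R_def sum_nonneg)
            have Tn: "T n \<omega> \<ge> 0" by (simp add: T_def)
            have W0: "W \<ge> 0" using Rn Tn by (simp add: W_def)
            have cn: "\<bar>c n - 1\<bar> \<le> \<eta>" "c n \<le> 1 + \<eta>" "0 \<le> c n"
              using elim(4,6) by (auto simp: dist_real_def c_def)
            have "R n \<omega> / (L (real n))\<^sup>2 \<le> (\<eta> * l\<^sup>2 / 4) / l\<^sup>2"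
              using Rl Rn l(1) elim(5) by (intro frac_le power_mono) auto
            also have "\<dots> = \<eta> / 4" using l(1) by simp
            finally have "2 * (R n \<omega> / (L (real n))\<^sup>2) \<le> 2 * (\<eta> / 4)"
              by (rule mult_left_mono) simp
            then have "2 * (R n \<omega> / (L (real n))\<^sup>2) \<le> \<eta> / 2" by (rule order_trans) simp
            moreover have "2 * T n \<omega> \<le> \<eta> / 2" using Tl by simp
            ultimately have "W \<le> \<eta> / 2 + \<eta> / 2"
              unfolding W_def times_divide_eq_right by (rule add_mono)
            then have "W \<le> \<eta>" by simp
            have "\<bar>D n \<omega>\<bar> \<le> \<bar>c n - 1\<bar> * V n \<omega> + c n * (W + 2 * sqrt (V n \<omega> * W))"
              using jackknife_variance_bound[OF h_symmetric m elim(6) L0, of "\<lambda>k. X k \<omega>" "\<lambda>i. h1 (X i \<omega>)" \<theta>]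
              unfolding D_def c_def V_def W_def R_def T_def by simp
            also have "\<dots> \<le> \<eta> * K + (1 + \<eta>) * (\<eta> + 2 * sqrt (K * \<eta>))"
              using cn VK V0 W0 \<open>W \<le> \<eta>\<close> K0 \<eta>(2)
              by (intro add_mono mult_mono) (auto intro!: add_nonneg_nonneg mult_mono)
            also have "\<dots> < \<epsilon>" by (rule \<eta>(1))
            finally show False using D by simp
          qed
        qed (use Em in auto)
        also have "\<dots> \<le> measure M E1 + measure M (E2 \<union> E3)"
          using Em by (intro measure_Un_le) auto
        also have "measure M (E2 \<union> E3) \<le> measure M E2 + measure M E3"
          using Em by (intro measure_Un_le) auto
        finally show ?case
          using elim(1-3) \<delta> unfolding E1_def[symmetric] E2_def[symmetric] E3_def[symmetric] by linarith
      qed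
    qed (rule always_eventually, simp add: less_le_trans[OF _ measure_nonneg])
  qed
  then show ?thesis unfolding D_def .
qed

end
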